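(* Let $d\ge2$ be an integer and let $\psi=(\psi(\tau_1,\dots,\tau_d))_{(\tau_1,\dots,\tau_d)\in\Theta^d}$ be a $d$-admissible, $p$-integrable family. For $S\in\Theta$ set $$V(S)=\operatorname*{ess\,sup}_{(\tau_1,\dots,\tau_d)\in\Theta_S^d}\rho_{S,\tau_1\vee\dots\vee\tau_d}[\psi(\tau_1,\dots,\tau_d)],$$ and assume $V(S)\in L^p$ for each $S\in\Theta$. For $i\in\{1,\dots,d\}$ and $S\in\Theta$ define $$u^{(i)}(S)=\operatorname*{ess\,sup}_{(\tau_1,\dots,\tau_{i-1},\tau_{i+1},\dots,\tau_d)\in\Theta_S^{d-1}}\rho_{S,\tau_1\vee\dots\vee\tau_{i-1}\vee S\vee\tau_{i+1}\vee\dots\vee\tau_d}[\psi(\tau_1,\dots,\tau_{i-1},S,\tau_{i+1},\dots,\tau_d)],$$ $$\phi(S)=u^{(1)}(S)\vee\dots\vee u^{(d)}(S),\qquad u(S)=\operatorname*{ess\,sup}_{\tau\in\Theta_S}\rho_{S,\tau}[\phi(\tau)].$$ Then for each $S\in\Theta$, $u(S)=V(S)$ a.s.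
   Context: Let $T>0$ be fixed and let $(\Omega,\mathcal F,P)$ be a complete probability space with a right-continuous complete filtration $(\mathcal F_t)_{t\in[0,T]}$. Equalities and inequalities between random variables, and equalities between measurable sets, are understood $P$-a.s. Let $(\theta_k)_{k\in\mathbb N}$ be a sequence of stopping times with $\theta_0=0$, $\theta_k\le\theta_{k+1}$ a.s. for all $k$, and $\lim_k\theta_k=T$ a.s. $\Theta$ (Bermudan stopping strategies) is the set of stopping times of the form $\tau=\sum_{k\ge0}\theta_k\mathbf 1_{A_k}+T\mathbf 1_{\bar A}$, where $\{(A_k)_{k\ge 0},\bar A\}$ is a partition of $\Omega$ with $A_k\in\mathcal F_{\theta_k}$ and $\bar A\in\mathcal F_T$. For $S\in\Theta$, $\Theta_S=\{\nu\in\Theta:\nu\ge S\text{ a.s.}\}$. Fix $p\in[1,+\infty]$. A family $\xi=(\xi(\tau))_{\tau\in\Theta}$ of real random variables is admissible if $\xi(\tau)$ is $\mathcal F_\tau$-measurable and $\xi(\tau)=\xi(\tau')$ a.s. on $\{\tau=\tau'\}$ for all $\tau,\tau'\in\Theta$; it is $p$-integrable if each $\xi(\tau)\in L^p$. A family $(\psi(\tau_1,\dots,\tau_d))_{(\tau_1,\dots,\tau_d)\in\Theta^d}$ is $d$-admissible if $\psi(\tau_1,\dots,\tau_d)$ is $\mathcal F_{\tau_1\vee\dots\vee\tau_d}$-measurable and $\psi(\tau_1,\dots,\tau_d)=\psi(\tilde\tau_1,\dots,\tilde\tau_d)$ on $\bigcap_i\{\tau_i=\tilde\tau_i\}$; it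 is $p$-integrable if each $\psi(\tau_1,\dots,\tau_d)\in L^p$. Bi-admissible means $2$-admissible. The operators $\rho_{S,\tau}$, $S,\tau\in\Theta$, satisfy: (i) $\rho_{S,\tau}:L^p(\mathcal F_\tau)\to L^p(\mathcal F_S)$. (ii) (admissibility) $\rho_{S,\tau}[\eta]=\rho_{S',\tau}[\eta]$ a.s. on $\{S=S'\}$. (iii) (knowledge preservation) $\rho_{\tau,S}[\eta]=\eta$ for all $\eta\in L^p(\mathcal F_S)$, $\tau\in\Theta_S$. (iv) (monotonicity) $\rho_{S,\tau}[\eta_1]\le\rho_{S,\tau}[\eta_2]$ if $\eta_1\le\eta_2$ a.s. (v) (consistency) $\rho_{S,\theta}[\rho_{\theta,\tau}[\eta]]=\rho_{S,\tau}[\eta]$ for $S\le\theta\le\tau$ in $\Theta$, $\eta\in L^p(\mathcal F_\tau)$. (vi) (generalized zero-one law) $\mathbf 1_A\rho_{S,\tau}[\xi(\tau)]=\mathbf 1_A\rho_{S,\tau'}[\xi(\tau')]$ for every admissible $p$-integrable family $\xi$, $A\in\mathcal F_S$, $\tau,\tau'\in\Theta_S$ with $\tau=\tau'$ on $A$. (vi bis) For every bi-admissible $p$-integrable family $\chi$ and all Bermudan stopping times: $\mathbf 1_{\{\tau_1=\tau_1'\}}\rho_{\tau_1,\tau_1\vee\tau_2}[\chi(\tau_1,\tau_2)]=\mathbf 1_{\{\tau_1=\tau_1'\}}\rho_{\tau_1',\tau_1'\vee\tau_2}[\chi(\tau_1',\tau_2)]$ and $\mathbf 1_{\{\tau_2=\tau_2'\}}\rho_{\tau_2,\tau_1\vee\tau_2}[\chi(\tau_1,\tau_2)]=\mathbf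 1_{\{\tau_2=\tau_2'\}}\rho_{\tau_2',\tau_1\vee\tau_2'}[\chi(\tau_1,\tau_2')]$. (vi ter) For every bi-admissible $p$-integrable family $\chi$, all $\tau_1,\tau_2\in\Theta$ and $A\in\mathcal F_{\tau_1\wedge\tau_2}$ such that $\tau_1\wedge\tau_2=\tau_1$ and $\tau_1\vee\tau_2=\tau_2$ a.s. on $A$: $\mathbf 1_A\rho_{\tau_1\wedge\tau_2,\tau_1\vee\tau_2}[\chi(\tau_1\wedge\tau_2,\tau_1\vee\tau_2)]=\mathbf 1_A\rho_{\tau_1\wedge\tau_2,\tau_1\vee\tau_2}[\chi(\tau_1,\tau_2)]=\mathbf 1_A\rho_{\tau_1,\tau_1\vee\tau_2}[\chi(\tau_1,\tau_2)]$, and $\mathbf 1_A\rho_{\tau_1\wedge\tau_2,\tau_1\vee\tau_2}[\chi(\tau_1\vee\tau_2,\tau_1\wedge\tau_2)]=\mathbf 1_A\rho_{\tau_1\wedge\tau_2,\tau_1\vee\tau_2}[\chi(\tau_2,\tau_1)]=\mathbf 1_A\rho_{\tau_1,\tau_1\vee\tau_2}[\chi(\tau_2,\tau_1)]$. (vii) (monotone Fatou property) $\rho_{S,\tau}[\eta]\le\liminf_n\rho_{S,\tau}[\eta_n]$ whenever $(\eta_n)\subset L^p(\mathcal F_\tau)$ is non-decreasing, $\sup_n\eta_n\in L^p$ and $\eta_n\uparrow\eta$ a.s. ($d$-property) For every $d$-admissible $p$-integrable family $\chi$, all $(\tau_1,\dots,\tau_d),(\tau_1',\dots,\tau_d')\in\Theta^d$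 and $A\in\mathcal F_{\tau_1\wedge\dots\wedge\tau_d}$ with $\tau_i=\tau_i'$ on $A$ for all $i$: $\mathbf 1_A\rho_{\tau_1\wedge\dots\wedge\tau_d,\tau_1\vee\dots\vee\tau_d}[\chi(\tau_1,\dots,\tau_d)]=\mathbf 1_A\rho_{\tau_1'\wedge\dots\wedge\tau_d',\tau_1'\vee\dots\vee\tau_d'}[\chi(\tau_1',\dots,\tau_d')]$. *)

theory Defs
  imports "HOL-Probability.Probability"
begin

(* The essential supremum of a family of random variables (the library's esssup is that of a
   single function). It is determined only up to a null set; for measurable X i on a probability
   space it always exists in the extended reals, and ess_sup picks one version. *)

definition is_ess_sup ::
  "'a measure \<Rightarrow> 'i set \<Rightarrow> ('i \<Rightarrow> 'a \<Rightarrow> ereal) \<Rightarrow> ('a \<Rightarrow> ereal) \<Rightarrow> bool" where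
  "is_ess_sup M I X Y \<longleftrightarrow>
     Y \<in> borel_measurable M \<and>
     (\<forall>i\<in>I. AE x in M. X i x \<le> Y x) \<and>
     (\<forall>Z\<in>borel_measurable M. (\<forall>i\<in>I. AE x in M. X i x \<le> Z x) \<longrightarrow> (AE x in M. Y x \<le> Z x))"

definition ess_sup :: "'a measure \<Rightarrow> 'i set \<Rightarrow> ('i \<Rightarrow> 'a \<Rightarrow> ereal) \<Rightarrow> 'a \<Rightarrow> ereal" where
  "ess_sup M I X = (SOME Y. is_ess_sup M I X Y)"

(* Representatives of elements of L^p with respect to the sub-sigma-algebra given by sets G;
   G serves only for measurability, integrals are taken with respect to M. *)

definition Lp_space :: "'a measure \<Rightarrow> ennreal \<Rightarrow> 'a measure \<Rightarrow> ('a \<Rightarrow> real) set" where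
  "Lp_space M p G = {f \<in> borel_measurable G.
     if p = \<infinity> then esssup M (\<lambda>x. ereal \<bar>f x\<bar>) < \<infinity>
     else integrable M (\<lambda>x. \<bar>f x\<bar> powr enn2real p)}"

(* A d-tuple of times is a function in {1..d} \<rightarrow>\<^sub>E \<Theta>; these are its pointwise maximum and minimum. *)

definition tuple_max :: "nat \<Rightarrow> (nat \<Rightarrow> 'a \<Rightarrow> real) \<Rightarrow> 'a \<Rightarrow> real" where
  "tuple_max d \<tau> = (\<lambda>x. MAX i\<in>{1..d}. \<tau> i x)"

definition tuple_min :: "nat \<Rightarrow> (nat \<Rightarrow> 'a \<Rightarrow> real) \<Rightarrow> 'a \<Rightarrow> real" where
  "tuple_min d \<tau> = (\<lambda>x. MIN i\<in>{1..d}. \<tau> i x)"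

(* The filtration is indexed by all reals so that the library's stopping times apply, but only
   F t with t in [0, T] matters: for times with values in [0, T], neither being a stopping time
   nor the sigma-algebra pre_sigma depends on F t for t outside [0, T], and a filtration on [0, T]
   extends by F t = F 0 for t < 0 and F t = F T for t > T. *)

locale bermudan = prob_space M + complete_measure M + filtration "space M" F
  for M :: "'a measure" and F :: "real \<Rightarrow> 'a measure" +
  fixes T :: real and \<theta> :: "nat \<Rightarrow> 'a \<Rightarrow> real"
  assumes T_pos: "0 < T"
    and sets_F: "\<And>t. sets (F t) \<subseteq> sets M"
    and F_complete: "null_sets M \<subseteq> sets (F 0)"
    and F_right_continuous: "\<And>t. t \<in> {0..<T} \<Longrightarrow> sets (F t) = (\<Inter>s\<in>{t<..T}. sets (F s))"
    and \<theta>_stopping: "\<And>k. stopping_time F (\<theta> k)"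
    and \<theta>_range: "\<And>k x. x \<in> space M \<Longrightarrow> \<theta> k x \<in> {0..T}"
    and \<theta>_0: "AE x in M. \<theta> 0 x = 0"
    and \<theta>_mono: "\<And>k. AE x in M. \<theta> k x \<le> \<theta> (Suc k) x"
    and \<theta>_lim: "AE x in M. (\<lambda>k. \<theta> k x) \<longlonglongrightarrow> T"
begin

definition \<Theta> :: "('a \<Rightarrow> real) set" where
  "\<Theta> = {\<tau>. stopping_time F \<tau> \<and> (\<forall>x\<in>space M. \<tau> x \<in> {0..T}) \<and>
     (\<exists>A B. (\<forall>k. A k \<in> sets (pre_sigma (\<theta> k))) \<and> B \<in> sets (F T) \<and>
        disjoint_family A \<and> (\<Union>k. A k) \<inter> B = {} \<and> (\<Union>k. A k) \<union> B = space M \<and>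
        (AE x in M. \<tau> x = (\<Sum>k. \<theta> k x * indicator (A k) x) + T * indicator B x))}"

definition \<Theta>_from :: "('a \<Rightarrow> real) \<Rightarrow> ('a \<Rightarrow> real) set" where
  "\<Theta>_from S = {\<nu> \<in> \<Theta>. AE x in M. S x \<le> \<nu> x}"

definition admissible :: "(('a \<Rightarrow> real) \<Rightarrow> 'a \<Rightarrow> real) \<Rightarrow> bool" where
  "admissible \<xi> \<longleftrightarrow>
     (\<forall>\<tau>\<in>\<Theta>. \<xi> \<tau> \<in> borel_measurable (pre_sigma \<tau>)) \<and>
     (\<forall>\<tau>\<in>\<Theta>. \<forall>\<tau>'\<in>\<Theta>. AE x in M. \<tau> x = \<tau>' x \<longrightarrow> \<xi> \<tau> x = \<xi> \<tau>' x)"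

definition p_integrable :: "ennreal \<Rightarrow> (('a \<Rightarrow> real) \<Rightarrow> 'a \<Rightarrow> real) \<Rightarrow> bool" where
  "p_integrable p \<xi> \<longleftrightarrow> (\<forall>\<tau>\<in>\<Theta>. \<xi> \<tau> \<in> Lp_space M p M)"

definition d_admissible :: "nat \<Rightarrow> ((nat \<Rightarrow> 'a \<Rightarrow> real) \<Rightarrow> 'a \<Rightarrow> real) \<Rightarrow> bool" where
  "d_admissible d \<psi> \<longleftrightarrow>
     (\<forall>\<tau>\<in>{1..d} \<rightarrow>\<^sub>E \<Theta>. \<psi> \<tau> \<in> borel_measurable (pre_sigma (tuple_max d \<tau>))) \<and>
     (\<forall>\<tau>\<in>{1..d} \<rightarrow>\<^sub>E \<Theta>. \<forall>\<tau>'\<in>{1..d} \<rightarrow>\<^sub>E \<Theta>.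
        AE x in M. (\<forall>i\<in>{1..d}. \<tau> i x = \<tau>' i x) \<longrightarrow> \<psi> \<tau> x = \<psi> \<tau>' x)"

definition d_p_integrable ::
  "ennreal \<Rightarrow> nat \<Rightarrow> ((nat \<Rightarrow> 'a \<Rightarrow> real) \<Rightarrow> 'a \<Rightarrow> real) \<Rightarrow> bool" where
  "d_p_integrable p d \<psi> \<longleftrightarrow> (\<forall>\<tau>\<in>{1..d} \<rightarrow>\<^sub>E \<Theta>. \<psi> \<tau> \<in> Lp_space M p M)"

definition bi_admissible :: "(('a \<Rightarrow> real) \<Rightarrow> ('a \<Rightarrow> real) \<Rightarrow> 'a \<Rightarrow> real) \<Rightarrow> bool" where
  "bi_admissible \<zeta> \<longleftrightarrow> d_admissible 2 (\<lambda>\<tau>. \<zeta> (\<tau> 1) (\<tau> 2))"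

definition bi_p_integrable ::
  "ennreal \<Rightarrow> (('a \<Rightarrow> real) \<Rightarrow> ('a \<Rightarrow> real) \<Rightarrow> 'a \<Rightarrow> real) \<Rightarrow> bool" where
  "bi_p_integrable p \<zeta> \<longleftrightarrow> d_p_integrable p 2 (\<lambda>\<tau>. \<zeta> (\<tau> 1) (\<tau> 2))"

end

(* \<rho> S \<tau> acts on representatives; nothing is assumed about it for times outside \<Theta> or
   arguments outside L^p. On functions, sup and inf are the pointwise maximum and minimum. *)

locale bermudan_operators = bermudan M F T \<theta>
  for M :: "'a measure" and F T \<theta> +
  fixes p :: ennreal
    and \<rho> :: "('a \<Rightarrow> real) \<Rightarrow> ('a \<Rightarrow> real) \<Rightarrow> ('a \<Rightarrow> real) \<Rightarrow> 'a \<Rightarrow> real"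
  assumes p_ge_1: "1 \<le> p"
    and \<rho>_Lp: "\<And>S \<tau> \<eta>. S \<in> \<Theta> \<Longrightarrow> \<tau> \<in> \<Theta> \<Longrightarrow> \<eta> \<in> Lp_space M p (pre_sigma \<tau>)
      \<Longrightarrow> \<rho> S \<tau> \<eta> \<in> Lp_space M p (pre_sigma S)"
    and \<rho>_admissible: "\<And>S S' \<tau> \<eta>. S \<in> \<Theta> \<Longrightarrow> S' \<in> \<Theta> \<Longrightarrow> \<tau> \<in> \<Theta>
      \<Longrightarrow> \<eta> \<in> Lp_space M p (pre_sigma \<tau>)
      \<Longrightarrow> AE x in M. S x = S' x \<longrightarrow> \<rho> S \<tau> \<eta> x = \<rho> S' \<tau> \<eta> x"
    and \<rho>_knowledge_preservation: "\<And>S \<tau> \<eta>. S \<in> \<Theta> \<Longrightarrow> \<tau> \<in> \<Theta>_from S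
      \<Longrightarrow> \<eta> \<in> Lp_space M p (pre_sigma S) \<Longrightarrow> AE x in M. \<rho> \<tau> S \<eta> x = \<eta> x"
    and \<rho>_mono: "\<And>S \<tau> \<eta>1 \<eta>2. S \<in> \<Theta> \<Longrightarrow> \<tau> \<in> \<Theta>
      \<Longrightarrow> \<eta>1 \<in> Lp_space M p (pre_sigma \<tau>) \<Longrightarrow> \<eta>2 \<in> Lp_space M p (pre_sigma \<tau>)
      \<Longrightarrow> AE x in M. \<eta>1 x \<le> \<eta>2 x \<Longrightarrow> AE x in M. \<rho> S \<tau> \<eta>1 x \<le> \<rho> S \<tau> \<eta>2 x"
    and \<rho>_consistency: "\<And>S \<nu> \<tau> \<eta>. S \<in> \<Theta> \<Longrightarrow> \<nu> \<in> \<Theta>_from S \<Longrightarrow> \<tau> \<in> \<Theta>_from \<nu>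
      \<Longrightarrow> \<eta> \<in> Lp_space M p (pre_sigma \<tau>)
      \<Longrightarrow> AE x in M. \<rho> S \<nu> (\<rho> \<nu> \<tau> \<eta>) x = \<rho> S \<tau> \<eta> x"
    and \<rho>_zero_one: "\<And>\<xi> S \<tau> \<tau>' A. admissible \<xi> \<Longrightarrow> p_integrable p \<xi> \<Longrightarrow> S \<in> \<Theta>
      \<Longrightarrow> A \<in> sets (pre_sigma S) \<Longrightarrow> \<tau> \<in> \<Theta>_from S \<Longrightarrow> \<tau>' \<in> \<Theta>_from S
      \<Longrightarrow> AE x in M. x \<in> A \<longrightarrow> \<tau> x = \<tau>' x
      \<Longrightarrow> AE x in M. indicator A x * \<rho> S \<tau> (\<xi> \<tau>) x = indicator A x * \<rho> S \<tau>' (\<xi> \<tau>') x"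
    and \<rho>_bi_1: "\<And>\<zeta> \<tau>1 \<tau>1' \<tau>2. bi_admissible \<zeta> \<Longrightarrow> bi_p_integrable p \<zeta>
      \<Longrightarrow> \<tau>1 \<in> \<Theta> \<Longrightarrow> \<tau>1' \<in> \<Theta> \<Longrightarrow> \<tau>2 \<in> \<Theta>
      \<Longrightarrow> AE x in M. indicator {x. \<tau>1 x = \<tau>1' x} x * \<rho> \<tau>1 (sup \<tau>1 \<tau>2) (\<zeta> \<tau>1 \<tau>2) x
                   = indicator {x. \<tau>1 x = \<tau>1' x} x * \<rho> \<tau>1' (sup \<tau>1' \<tau>2) (\<zeta> \<tau>1' \<tau>2) x"
    and \<rho>_bi_2: "\<And>\<zeta> \<tau>1 \<tau>2 \<tau>2'. bi_admissible \<zeta> \<Longrightarrow> bi_p_integrable p \<zeta>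
      \<Longrightarrow> \<tau>1 \<in> \<Theta> \<Longrightarrow> \<tau>2 \<in> \<Theta> \<Longrightarrow> \<tau>2' \<in> \<Theta>
      \<Longrightarrow> AE x in M. indicator {x. \<tau>2 x = \<tau>2' x} x * \<rho> \<tau>2 (sup \<tau>1 \<tau>2) (\<zeta> \<tau>1 \<tau>2) x
                   = indicator {x. \<tau>2 x = \<tau>2' x} x * \<rho> \<tau>2' (sup \<tau>1 \<tau>2') (\<zeta> \<tau>1 \<tau>2') x"
    and \<rho>_ter: "\<And>\<zeta> \<tau>1 \<tau>2 A. bi_admissible \<zeta> \<Longrightarrow> bi_p_integrable p \<zeta>
      \<Longrightarrow> \<tau>1 \<in> \<Theta> \<Longrightarrow> \<tau>2 \<in> \<Theta> \<Longrightarrow> A \<in> sets (pre_sigma (inf \<tau>1 \<tau>2))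
      \<Longrightarrow> AE x in M. x \<in> A \<longrightarrow> inf \<tau>1 \<tau>2 x = \<tau>1 x \<and> sup \<tau>1 \<tau>2 x = \<tau>2 x
      \<Longrightarrow> AE x in M.
            indicator A x * \<rho> (inf \<tau>1 \<tau>2) (sup \<tau>1 \<tau>2) (\<zeta> (inf \<tau>1 \<tau>2) (sup \<tau>1 \<tau>2)) x
              = indicator A x * \<rho> (inf \<tau>1 \<tau>2) (sup \<tau>1 \<tau>2) (\<zeta> \<tau>1 \<tau>2) x \<and>
            indicator A x * \<rho> (inf \<tau>1 \<tau>2) (sup \<tau>1 \<tau>2) (\<zeta> \<tau>1 \<tau>2) x
              = indicator A x * \<rho> \<tau>1 (sup \<tau>1 \<tau>2) (\<zeta> \<tau>1 \<tau>2) x \<and>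
            indicator A x * \<rho> (inf \<tau>1 \<tau>2) (sup \<tau>1 \<tau>2) (\<zeta> (sup \<tau>1 \<tau>2) (inf \<tau>1 \<tau>2)) x
              = indicator A x * \<rho> (inf \<tau>1 \<tau>2) (sup \<tau>1 \<tau>2) (\<zeta> \<tau>2 \<tau>1) x \<and>
            indicator A x * \<rho> (inf \<tau>1 \<tau>2) (sup \<tau>1 \<tau>2) (\<zeta> \<tau>2 \<tau>1) x
              = indicator A x * \<rho> \<tau>1 (sup \<tau>1 \<tau>2) (\<zeta> \<tau>2 \<tau>1) x"
    (* The limit of a non-decreasing sequence is a.s. its supremum, so requiring the supremum to be
       in L^p is the membership of \<eta>. *)
    and \<rho>_Fatou: "\<And>S \<tau> \<eta> \<eta>s. S \<in> \<Theta> \<Longrightarrow> \<tau> \<in> \<Theta>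
      \<Longrightarrow> (\<And>n::nat. \<eta>s n \<in> Lp_space M p (pre_sigma \<tau>))
      \<Longrightarrow> (\<And>n. AE x in M. \<eta>s n x \<le> \<eta>s (Suc n) x)
      \<Longrightarrow> \<eta> \<in> Lp_space M p (pre_sigma \<tau>)
      \<Longrightarrow> AE x in M. (\<lambda>n. \<eta>s n x) \<longlonglongrightarrow> \<eta> x
      \<Longrightarrow> AE x in M. ereal (\<rho> S \<tau> \<eta> x) \<le> liminf (\<lambda>n. ereal (\<rho> S \<tau> (\<eta>s n) x))"
begin

definition d_property :: "nat \<Rightarrow> bool" where
  "d_property d \<longleftrightarrow>
     (\<forall>\<zeta>. d_admissible d \<zeta> \<longrightarrow> d_p_integrable p d \<zeta> \<longrightarrow>
        (\<forall>\<tau>\<in>{1..d} \<rightarrow>\<^sub>E \<Theta>. \<forall>\<tau>'\<in>{1..d} \<rightarrow>\<^sub>E \<Theta>. \<forall>A\<in>sets (pre_sigma (tuple_min d \<tau>)).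
           (\<forall>i\<in>{1..d}. AE x in M. x \<in> A \<longrightarrow> \<tau> i x = \<tau>' i x) \<longrightarrow>
           (AE x in M. indicator A x * \<rho> (tuple_min d \<tau>) (tuple_max d \<tau>) (\<zeta> \<tau>) x
                     = indicator A x * \<rho> (tuple_min d \<tau>') (tuple_max d \<tau>') (\<zeta> \<tau>') x)))"

definition V :: "nat \<Rightarrow> ((nat \<Rightarrow> 'a \<Rightarrow> real) \<Rightarrow> 'a \<Rightarrow> real) \<Rightarrow> ('a \<Rightarrow> real) \<Rightarrow> 'a \<Rightarrow> ereal" where
  "V d \<psi> S = ess_sup M ({1..d} \<rightarrow>\<^sub>E \<Theta>_from S) (\<lambda>\<tau> x. ereal (\<rho> S (tuple_max d \<tau>) (\<psi> \<tau>) x))"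

definition u_coord ::
  "nat \<Rightarrow> ((nat \<Rightarrow> 'a \<Rightarrow> real) \<Rightarrow> 'a \<Rightarrow> real) \<Rightarrow> nat \<Rightarrow> ('a \<Rightarrow> real) \<Rightarrow> 'a \<Rightarrow> ereal" where
  "u_coord d \<psi> i S = ess_sup M (({1..d} - {i}) \<rightarrow>\<^sub>E \<Theta>_from S)
     (\<lambda>\<tau> x. ereal (\<rho> S (tuple_max d (\<tau>(i := S))) (\<psi> (\<tau>(i := S))) x))"

definition \<phi> :: "nat \<Rightarrow> ((nat \<Rightarrow> 'a \<Rightarrow> real) \<Rightarrow> 'a \<Rightarrow> real) \<Rightarrow> ('a \<Rightarrow> real) \<Rightarrow> 'a \<Rightarrow> ereal" where
  "\<phi> d \<psi> S x = (MAX i\<in>{1..d}. u_coord d \<psi> i S x)"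

(* \<phi> is a.s. finite once V is: taking all times equal to S gives \<psi>(S,...,S) \<le> \<phi>(S) \<le> V(S).
   Hence real_of_ereal only selects a real version of \<phi>. *)

definition u :: "nat \<Rightarrow> ((nat \<Rightarrow> 'a \<Rightarrow> real) \<Rightarrow> 'a \<Rightarrow> real) \<Rightarrow> ('a \<Rightarrow> real) \<Rightarrow> 'a \<Rightarrow> ereal" where
  "u d \<psi> S = ess_sup M (\<Theta>_from S) (\<lambda>\<tau> x. ereal (\<rho> S \<tau> (\<lambda>y. real_of_ereal (\<phi> d \<psi> \<tau> y)) x))"

end

end

theory Submission
  imports Defs
begin

text \<open>
  Both inequalities rest on the reward \<open>\<rho> S (tuple_max d \<tau>) (\<psi> \<tau>)\<close> of a tuple \<open>\<tau>\<close> seen from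
  \<open>S\<close>.

  For \<open>V \<le> u\<close>, let \<open>m\<close> be the minimum of the tuple. On the event \<open>\<tau> i = m\<close> the tuple agrees
  with one whose component \<open>i\<close> is \<open>m\<close> itself, so by the \<open>d\<close>-property its reward seen from \<open>m\<close> is
  at most \<open>\<phi> m\<close> (\<open>reward_min_le_\<phi>\<close>). Applying \<open>\<rho> S m\<close> and consistency bounds the
  reward seen from \<open>S\<close> by a competitor of \<open>u S\<close>.

  For \<open>u \<le> V\<close>, note that \<open>\<phi> \<le> V\<close>, since every tuple that competes in \<open>\<phi>\<close> competes in
  \<open>V\<close>. It remains to see that \<open>V\<close> is a supermartingale, \<open>\<rho> S \<tau> (V \<tau>) \<le> V S\<close>
  (\<open>\<rho>_V_le_V\<close>). The rewards seen from \<open>\<tau>\<close> form a directed family, hence \<open>V \<tau>\<close> is the limit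
  of an increasing sequence of them, and the Fatou property together with consistency gives the claim.

  Directedness needs locality (\<open>reward_local\<close>): two tuples that agree on an event known at time
  \<open>S\<close> have the same reward there. The zero-one law concerns families indexed by one time, and
  \<open>\<rho> S\<close> need not respect events known at \<open>S\<close> when the time is kept fixed. The way around
  is to freeze the tuple at a single time \<open>\<kappa>\<close>: the family
  \<open>\<psi> (min (\<tau> 1) \<kappa>, \<dots>, min (\<tau> d) \<kappa>)\<close> is admissible, equals the terminal reward at
  the maximum of the tuple, and forgets the tuple wherever \<open>\<kappa>\<close> is moved back to \<open>S\<close>.
\<close>

section \<open>Essential suprema\<close>

lemma is_ess_supD:
  assumes "is_ess_sup M I X Y"
  shows "Y \<in> borel_measurable M" "i \<in> I \<Longrightarrow> AE x in M. X i x \<le> Y x"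
    "Z \<in> borel_measurable M \<Longrightarrow> (\<And>i. i \<in> I \<Longrightarrow> AE x in M. X i x \<le> Z x) \<Longrightarrow> AE x in M. Y x \<le> Z x"
proof -
  show "Y \<in> borel_measurable M" using assms unfolding is_ess_sup_def by (rule conjunct1)
  note bounds = assms[unfolded is_ess_sup_def, THEN conjunct2]
  show "AE x in M. X i x \<le> Y x" if "i \<in> I" by (rule bspec[OF bounds[THEN conjunct1] that])
  show "AE x in M. Y x \<le> Z x" if "Z \<in> borel_measurable M" "\<And>i. i \<in> I \<Longrightarrow> AE x in M. X i x \<le> Z x"
    by (rule mp[OF bspec[OF bounds[THEN conjunct2] that(1)]]) (rule ballI, rule that(2))
qed

text \<open>Choose countable subfamilies whose unions have measure tending to the supremum over all countable
  subfamilies. Their union attains it, so adding one more set can add only a null set.\<close>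

lemma (in finite_measure) countable_essential_union:
  assumes A: "\<And>i. i \<in> I \<Longrightarrow> A i \<in> sets M"
  shows "\<exists>J\<subseteq>I. countable J \<and> (\<forall>i\<in>I. A i - (\<Union>j\<in>J. A j) \<in> null_sets M)"
proof -
  define \<C> where "\<C> = {J. J \<subseteq> I \<and> countable J}"
  define m where "m J = measure M (\<Union>j\<in>J. A j)" for J
  define s where "s = (SUP J\<in>\<C>. m J)"
  have bdd: "bdd_above (m ` \<C>)"
    by (rule bdd_aboveI[of _ "measure M (space M)"]) (auto simp: m_def bounded_measure)
  have ne: "\<C> \<noteq> {}" by (auto simp: \<C>_def)
  have "\<exists>J\<in>\<C>. s - 1 / real (Suc n) < m J" for n
    using less_cSUP_iff[OF ne bdd, of "s - 1 / real (Suc n)"] by (simp add: s_def[symmetric])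
  then obtain K where K: "\<And>n. K n \<in> \<C>" "\<And>n. s - 1 / real (Suc n) < m (K n)"
    by metis
  define J where "J = (\<Union>n. K n)"
  have J: "J \<in> \<C>" using K(1) by (auto simp: \<C>_def J_def)
  have meas: "(\<Union>j\<in>J'. A j) \<in> sets M" if "J' \<in> \<C>" for J'
    using that A by (intro sets.countable_UN') (auto simp: \<C>_def)
  have mono: "m J1 \<le> m J2" if "J1 \<subseteq> J2" "J2 \<in> \<C>" for J1 J2
    unfolding m_def using that meas by (intro finite_measure_mono) auto
  have s_le: "s \<le> m J"
  proof (rule LIMSEQ_le_const2)
    show "(\<lambda>n. s - 1 / real (Suc n)) \<longlonglongrightarrow> s"
      using tendsto_diff[OF tendsto_const LIMSEQ_Suc[OF lim_1_over_n], of s] by simp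
    show "\<exists>N. \<forall>n\<ge>N. s - 1 / real (Suc n) \<le> m J"
    proof (intro exI allI impI)
      fix n
      have "m (K n) \<le> m J" by (rule mono[OF _ J]) (auto simp: J_def)
      with K(2)[of n] show "s - 1 / real (Suc n) \<le> m J" by linarith
    qed
  qed
  have "A i - (\<Union>j\<in>J. A j) \<in> null_sets M" if i: "i \<in> I" for i
  proof -
    have iJ: "insert i J \<in> \<C>" using i J by (auto simp: \<C>_def)
    have "m (insert i J) \<le> s" unfolding s_def by (rule cSUP_upper[OF iJ bdd])
    moreover have "m (insert i J) = m J + measure M (A i - (\<Union>j\<in>J. A j))"
    proof -
      have "measure M ((\<Union>j\<in>J. A j) \<union> (A i - (\<Union>j\<in>J. A j))) = m J + measure M (A i - (\<Union>j\<in>J. A j))"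
        unfolding m_def by (rule finite_measure_Union) (use meas[OF J] A[OF i] in auto)
      then show ?thesis by (simp add: m_def Un_commute)
    qed
    ultimately have "measure M (A i - (\<Union>j\<in>J. A j)) = 0"
      using s_le measure_nonneg[of M "A i - (\<Union>j\<in>J. A j)"] by linarith
    then show ?thesis
      using meas[OF J] A[OF i] by (auto simp: null_sets_def emeasure_eq_measure)
  qed
  then show ?thesis using J by (auto simp: \<C>_def)
qed

text \<open>The superlevel sets at each rational level have a countable essential union. Collecting the
  indices for all rational levels gives one countable subfamily, and a failure of \<open>X i \<le> Y\<close>
  would show up at a rational level strictly between the two values.\<close>

lemma (in finite_measure) is_ess_sup_countable_SUP:
  assumes X [measurable]: "\<And>i. i \<in> I \<Longrightarrow> X i \<in> borel_measurable M"
  shows "\<exists>J\<subseteq>I. countable J \<and> is_ess_sup M I X (\<lambda>x. SUP i\<in>J. X i x)"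
proof -
  define A where "A q i = {x \<in> space M. ereal (real_of_rat q) < X i x}" for q i
  have "\<exists>J\<subseteq>I. countable J \<and> (\<forall>i\<in>I. A q i - (\<Union>j\<in>J. A q j) \<in> null_sets M)" for q
    by (rule countable_essential_union) (unfold A_def, measurable)
  then obtain K where K: "\<And>q. K q \<subseteq> I" "\<And>q. countable (K q)"
    "\<And>q i. i \<in> I \<Longrightarrow> A q i - (\<Union>j\<in>K q. A q j) \<in> null_sets M"
    by metis
  define J where "J = (\<Union>q. K q)"
  have J: "J \<subseteq> I" "countable J" using K by (auto simp: J_def)
  define Y where "Y = (\<lambda>x. SUP i\<in>J. X i x)"
  have "is_ess_sup M I X Y"
    unfolding is_ess_sup_def
  proof (intro conjI ballI impI)
    show "Y \<in> borel_measurable M"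
      unfolding Y_def using J by (intro borel_measurable_SUP) auto
  next
    fix i assume i: "i \<in> I"
    have "AE x in M. \<forall>q. x \<notin> A q i - (\<Union>j\<in>K q. A q j)"
      unfolding AE_all_countable using AE_not_in[OF K(3)[OF i]] by blast
    with AE_space[of M] show "AE x in M. X i x \<le> Y x"
    proof eventually_elim
      case (elim x)
      show ?case
      proof (rule ccontr)
        assume "\<not> X i x \<le> Y x"
        then obtain q where q: "Y x < ereal (real_of_rat q)" "ereal (real_of_rat q) < X i x"
          using ereal_dense3 by (meson not_le)
        with elim obtain j where j: "j \<in> K q" "ereal (real_of_rat q) < X j x"
          by (auto simp: A_def)
        then have "X j x \<le> Y x" unfolding Y_def by (intro SUP_upper) (auto simp: J_def)
        with j q show False by auto
      qed
    qed
  next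
    fix Z assume "Z \<in> borel_measurable M" and Z: "\<forall>i\<in>I. AE x in M. X i x \<le> Z x"
    have "AE x in M. \<forall>i\<in>J. X i x \<le> Z x"
      using Z J by (auto simp: AE_ball_countable)
    then show "AE x in M. Y x \<le> Z x"
      by eventually_elim (auto simp: Y_def intro: SUP_least)
  qed
  then show ?thesis using J by (auto simp: Y_def)
qed

lemma (in finite_measure) is_ess_sup_ess_sup:
  assumes "\<And>i. i \<in> I \<Longrightarrow> X i \<in> borel_measurable M"
  shows "is_ess_sup M I X (ess_sup M I X)"
proof -
  obtain Y where "is_ess_sup M I X Y"
    using is_ess_sup_countable_SUP[of I X] assms by auto
  then show ?thesis unfolding ess_sup_def by (rule someI[of "is_ess_sup M I X"])
qed

lemma is_ess_sup_unique_AE: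
  assumes "is_ess_sup M I X Y" "is_ess_sup M I X Z"
  shows "AE x in M. Y x = Z x"
proof -
  have "AE x in M. Y x \<le> Z x" "AE x in M. Z x \<le> Y x"
    using assms by (auto simp: is_ess_sup_def)
  then show ?thesis by eventually_elim auto
qed

lemma (in finite_measure) ess_sup_countable_SUP:
  assumes X: "\<And>i. i \<in> I \<Longrightarrow> X i \<in> borel_measurable M" and "I \<noteq> {}"
  shows "\<exists>s. (\<forall>n::nat. s n \<in> I) \<and> (AE x in M. ess_sup M I X x = (SUP n. X (s n) x))"
proof -
  obtain J where J: "J \<subseteq> I" "countable J" "is_ess_sup M I X (\<lambda>x. SUP i\<in>J. X i x)"
    using is_ess_sup_countable_SUP[of I X, OF X] by auto
  obtain i0 where i0: "i0 \<in> I" using \<open>I \<noteq> {}\<close> by auto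
  define s where "s = from_nat_into (insert i0 J)"
  have range_s: "range s = insert i0 J"
    unfolding s_def using J(2) by (intro range_from_nat_into) auto
  have "AE x in M. ess_sup M I X x = (SUP i\<in>J. X i x)"
    by (rule is_ess_sup_unique_AE[OF is_ess_sup_ess_sup[of I X, OF X] J(3)])
  moreover have "AE x in M. X i0 x \<le> (SUP i\<in>J. X i x)"
    using J(3) i0 by (auto simp: is_ess_sup_def)
  ultimately have eq: "AE x in M. ess_sup M I X x = (SUP n. X (s n) x)"
  proof eventually_elim
    case (elim x)
    have "(SUP n. X (s n) x) = (SUP i\<in>insert i0 J. X i x)"
      unfolding range_s[symmetric] by (simp add: image_image)
    with elim show ?case by (simp add: sup_absorb2)
  qed
  have "s n \<in> I" for n using rangeI[of s n] range_s J(1) i0 by auto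
  with eq show ?thesis by (intro exI[of _ s]) simp
qed

text \<open>In a directed family the countable supremum is reached monotonically: each member of the countable
  subfamily is merged with the upper bound chosen for its predecessors.\<close>

lemma (in finite_measure) ess_sup_directed:
  assumes X: "\<And>i. i \<in> I \<Longrightarrow> X i \<in> borel_measurable M" and "I \<noteq> {}"
    and dir: "\<And>i j. i \<in> I \<Longrightarrow> j \<in> I \<Longrightarrow>
      \<exists>k\<in>I. (AE x in M. X i x \<le> X k x) \<and> (AE x in M. X j x \<le> X k x)"
  shows "\<exists>s. (\<forall>n::nat. s n \<in> I) \<and> (AE x in M. incseq (\<lambda>n. X (s n) x)) \<and>
    (AE x in M. (\<lambda>n. X (s n) x) \<longlonglongrightarrow> ess_sup M I X x)"
proof -
  have "\<exists>s. (\<forall>n::nat. s n \<in> I) \<and> (AE x in M. ess_sup M I X x = (SUP n. X (s n) x))"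
    by (rule ess_sup_countable_SUP[OF _ \<open>I \<noteq> {}\<close>]) (rule X)
  then obtain r where "\<forall>n::nat. r n \<in> I" "AE x in M. ess_sup M I X x = (SUP n. X (r n) x)"
    by (elim exE conjE)
  then have r: "\<And>n. r n \<in> I" "AE x in M. ess_sup M I X x = (SUP n. X (r n) x)"
    by simp_all
  define k where "k i j = (SOME k. k \<in> I \<and> (AE x in M. X i x \<le> X k x) \<and> (AE x in M. X j x \<le> X k x))"
    for i j
  have k: "k i j \<in> I" "AE x in M. X i x \<le> X (k i j) x" "AE x in M. X j x \<le> X (k i j) x"
    if "i \<in> I" "j \<in> I" for i j
    using someI_ex[OF dir[OF that, unfolded Bex_def]] by (auto simp only: k_def)
  define s where "s = rec_nat (r 0) (\<lambda>n i. k i (r (Suc n)))"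
  have s_simps: "s 0 = r 0" "s (Suc n) = k (s n) (r (Suc n))" for n
    by (simp_all add: s_def)
  have s: "s n \<in> I" for n by (induction n) (auto simp: s_simps r k)
  have "AE x in M. X (s n) x \<le> X (s (Suc n)) x" for n
    using k(2)[OF s r(1)] by (simp add: s_simps)
  then have inc: "AE x in M. incseq (\<lambda>n. X (s n) x)"
    by (simp add: incseq_Suc_iff AE_all_countable)
  have "AE x in M. X (r n) x \<le> X (s n) x" for n
    using k(3)[OF s r(1)] by (cases n) (simp_all add: s_simps)
  then have ge: "AE x in M. \<forall>n. X (r n) x \<le> X (s n) x" by (simp add: AE_all_countable)
  have "is_ess_sup M I X (ess_sup M I X)" by (rule is_ess_sup_ess_sup) (rule X)
  then have "AE x in M. X (s n) x \<le> ess_sup M I X x" for n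
    using s by (simp add: is_ess_sup_def)
  then have le: "AE x in M. \<forall>n. X (s n) x \<le> ess_sup M I X x" by (simp add: AE_all_countable)
  from inc ge le r(2) have lim: "AE x in M. (\<lambda>n. X (s n) x) \<longlonglongrightarrow> ess_sup M I X x"
  proof eventually_elim
    case (elim x)
    have "(SUP n. X (s n) x) = ess_sup M I X x"
    proof (rule antisym)
      show "(SUP n. X (s n) x) \<le> ess_sup M I X x" using elim by (auto intro: SUP_least)
      show "ess_sup M I X x \<le> (SUP n. X (s n) x)" using elim by (auto intro: SUP_mono)
    qed
    with LIMSEQ_SUP[OF elim(1)] show ?case by simp
  qed
  with s inc show ?thesis by (intro exI[of _ s]) simp
qed

section \<open>Completed sub-sigma-algebras and integrability\<close>

text \<open>Sub-sigma-algebras that contain the null sets do not see the choice of version. The sigma-algebras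
  of Bermudan times are of this kind, so an essential supremum, which is only some version, is
  measurable at the time at which its members are.\<close>

lemma (in complete_measure) sets_AE_cong:
  assumes G: "null_sets M \<subseteq> sets G" "sets G \<subseteq> sets M"
    and B: "B \<in> sets G" and C: "C \<subseteq> space M" and eq: "AE x in M. x \<in> B \<longleftrightarrow> x \<in> C"
  shows "C \<in> sets G"
proof -
  obtain N where N: "N \<in> null_sets M" "{x \<in> space M. \<not> (x \<in> B \<longleftrightarrow> x \<in> C)} \<subseteq> N"
    using eq by (elim AE_E) (auto simp: null_sets_def)
  have "B \<subseteq> space M" using B G(2) sets.sets_into_space by blast
  then have "C - B \<subseteq> N" "B - C \<subseteq> N" using N(2) C by auto
  then have "C - B \<in> sets G" "B - C \<in> sets G"
    using complete2[OF _ N(1)] G(1) by blast+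
  moreover have "C = (B - (B - C)) \<union> (C - B)" by auto
  ultimately show ?thesis using B by (metis sets.Un sets.Diff)
qed

lemma (in complete_measure) measurable_AE_cong:
  assumes G: "null_sets M \<subseteq> sets G" "sets G \<subseteq> sets M" "space G = space M"
    and f: "f \<in> measurable G N" and g: "\<And>x. x \<in> space M \<Longrightarrow> g x \<in> space N"
    and eq: "AE x in M. f x = g x"
  shows "g \<in> measurable G N"
proof (rule measurableI)
  fix B assume "B \<in> sets N"
  then have "f -` B \<inter> space M \<in> sets G"
    using measurable_sets[OF f] G(3) by simp
  moreover have "AE x in M. x \<in> f -` B \<inter> space M \<longleftrightarrow> x \<in> g -` B \<inter> space M"
    using eq by eventually_elim simp
  ultimately have "g -` B \<inter> space M \<in> sets G"
    by (intro sets_AE_cong[OF G(1,2), of "f -` B \<inter> space M" "g -` B \<inter> space M"]) simp_all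
  then show "g -` B \<inter> space G \<in> sets G" by (simp add: G(3))
qed (simp add: g G(3))

lemma (in complete_measure) ess_sup_measurable_subalgebra:
  assumes fin: "finite_measure M"
    and G: "null_sets M \<subseteq> sets G" "sets G \<subseteq> sets M" "space G = space M"
    and X: "\<And>i. i \<in> I \<Longrightarrow> X i \<in> borel_measurable G" and "I \<noteq> {}"
  shows "ess_sup M I X \<in> borel_measurable G"
proof -
  interpret finite_measure M by fact
  have XM: "X i \<in> borel_measurable M" if "i \<in> I" for i
    using measurable_mono[of borel borel G M] G X[OF that] by auto
  have "\<exists>s. (\<forall>n::nat. s n \<in> I) \<and> (AE x in M. ess_sup M I X x = (SUP n. X (s n) x))"
    by (rule ess_sup_countable_SUP[OF _ \<open>I \<noteq> {}\<close>]) (rule XM)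
  then obtain s where s: "\<forall>n::nat. s n \<in> I" "AE x in M. ess_sup M I X x = (SUP n. X (s n) x)"
    by (elim exE conjE)
  show ?thesis
    by (rule measurable_AE_cong[OF G, of "\<lambda>x. SUP n. X (s n) x"])
       (use s X in \<open>auto intro!: borel_measurable_SUP\<close>)
qed

lemma Lp_space_change_algebra:
  "f \<in> Lp_space M p G \<Longrightarrow> f \<in> borel_measurable H \<Longrightarrow> f \<in> Lp_space M p H"
  unfolding Lp_space_def mem_Collect_eq by (elim conjE, intro conjI)

text \<open>This gives \<open>L\<^sup>p\<close> membership of the reduced reward, which lies between a
  single reward and the value function.\<close>

lemma Lp_space_between:
  assumes a: "a \<in> Lp_space M p M" and b: "b \<in> Lp_space M p M"
    and f: "f \<in> borel_measurable M" "f \<in> borel_measurable G"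
    and le: "AE x in M. a x \<le> f x" "AE x in M. f x \<le> b x"
  shows "f \<in> Lp_space M p G"
proof (cases "p = \<infinity>")
  case True
  have [measurable]: "a \<in> borel_measurable M" "b \<in> borel_measurable M" "f \<in> borel_measurable M"
    using a b f by (auto simp: Lp_space_def)
  let ?e = "\<lambda>h. esssup M (\<lambda>x. ereal \<bar>h x\<bar>)"
  have "?e f \<le> max (?e a) (?e b)"
  proof (rule esssup_I)
    show "AE x in M. ereal \<bar>f x\<bar> \<le> max (?e a) (?e b)"
      using le esssup_AE[of "\<lambda>x. ereal \<bar>a x\<bar>" M] esssup_AE[of "\<lambda>x. ereal \<bar>b x\<bar>" M]
    proof eventually_elim
      case (elim x)
      have "ereal \<bar>f x\<bar> \<le> max (ereal \<bar>a x\<bar>) (ereal \<bar>b x\<bar>)" using elim(1,2) by (auto simp: max_def)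
      then show ?case using elim(3,4) by (meson max.mono order_trans)
    qed
  qed measurable
  also have "\<dots> < \<infinity>" using a b True by (auto simp: Lp_space_def max_def)
  finally show ?thesis using True f by (simp add: Lp_space_def)
next
  case False
  define q where "q = enn2real p"
  have [measurable]: "a \<in> borel_measurable M" "b \<in> borel_measurable M" "f \<in> borel_measurable M"
    using a b f by (auto simp: Lp_space_def)
  have q: "0 \<le> q" by (simp add: q_def)
  have "integrable M (\<lambda>x. \<bar>a x\<bar> powr q + \<bar>b x\<bar> powr q)"
    using a b False by (simp add: Lp_space_def q_def)
  then have "integrable M (\<lambda>x. \<bar>f x\<bar> powr q)"
  proof (rule Bochner_Integration.integrable_bound)
    show "AE x in M. norm (\<bar>f x\<bar> powr q) \<le> norm (\<bar>a x\<bar> powr q + \<bar>b x\<bar> powr q)"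
      using le
    proof eventually_elim
      case (elim x)
      then consider "\<bar>f x\<bar> \<le> \<bar>a x\<bar>" | "\<bar>f x\<bar> \<le> \<bar>b x\<bar>" by linarith
      then have "\<bar>f x\<bar> powr q \<le> \<bar>a x\<bar> powr q \<or> \<bar>f x\<bar> powr q \<le> \<bar>b x\<bar> powr q"
        using powr_mono2[OF q abs_ge_zero] by blast
      then have "\<bar>f x\<bar> powr q \<le> \<bar>a x\<bar> powr q + \<bar>b x\<bar> powr q"
        using powr_ge_zero[of "\<bar>a x\<bar>" q] powr_ge_zero[of "\<bar>b x\<bar>" q] by linarith
      then show ?case by simp
    qed
  qed measurable
  then show ?thesis using False f by (simp add: Lp_space_def q_def)
qed

section \<open>Bermudan stopping times\<close>

context bermudan
begin

lemma sets_pre_sigma_subset_F_T: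
  assumes "stopping_time F \<sigma>" "\<And>x. x \<in> space M \<Longrightarrow> \<sigma> x \<le> T"
  shows "sets (pre_sigma \<sigma>) \<subseteq> sets (F T)"
proof
  fix A assume A: "A \<in> sets (pre_sigma \<sigma>)"
  then have "A \<subseteq> space M" using sets.sets_into_space[OF A] by (simp add: space_pre_sigma)
  then have "{x \<in> A. \<sigma> x \<le> T} = A" using assms(2) by auto
  then show "A \<in> sets (F T)" using sets_pre_sigmaD[OF assms(1) A, of T] by simp
qed

lemma null_sets_pre_sigma:
  assumes "stopping_time F \<sigma>" "\<And>x. x \<in> space M \<Longrightarrow> 0 \<le> \<sigma> x"
  shows "null_sets M \<subseteq> sets (pre_sigma \<sigma>)"
proof
  fix N assume N: "N \<in> null_sets M"
  show "N \<in> sets (pre_sigma \<sigma>)"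
  proof (rule sets_pre_sigmaI[OF assms(1)])
    fix t
    show "{x \<in> N. \<sigma> x \<le> t} \<in> sets (F t)"
    proof (cases "0 \<le> t")
      case True
      have "{x \<in> N. \<sigma> x \<le> t} \<in> null_sets M" by (rule complete2[OF _ N]) auto
      then show ?thesis using F_complete sets_F_mono[OF True] by blast
    next
      case False
      have "N \<subseteq> space M" using N by (auto dest: null_setsD2 sets.sets_into_space)
      then have "{x \<in> N. \<sigma> x \<le> t} = {}" using assms(2) False by force
      then show ?thesis by (metis sets.empty_sets)
    qed
  qed
qed

text \<open>Membership at the later time follows from membership at \<open>min \<sigma> \<tau>\<close>, since
  \<open>\<sigma> < \<tau>\<close> holds exactly where \<open>min \<sigma> \<tau> < \<tau>\<close>.\<close>

lemma pre_sigma_less: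
  assumes "stopping_time F \<sigma>" "stopping_time F \<tau>"
  shows "{x \<in> space M. \<sigma> x < \<tau> x} \<in> sets (pre_sigma \<sigma>)"
    and "{x \<in> space M. \<sigma> x < \<tau> x} \<in> sets (pre_sigma \<tau>)"
proof -
  have less: "{x \<in> space M. \<sigma> x < \<tau> x} \<in> sets (pre_sigma \<sigma>)"
    if "stopping_time F \<sigma>" "stopping_time F \<tau>" for \<sigma> \<tau>
    using stopping_time_less[OF that] by (simp add: pred_def space_pre_sigma)
  show "{x \<in> space M. \<sigma> x < \<tau> x} \<in> sets (pre_sigma \<sigma>)" by (rule less[OF assms])
  let ?m = "\<lambda>x. min (\<sigma> x) (\<tau> x)"
  have m: "stopping_time F ?m" by (rule stopping_time_min[OF assms])
  have "{x \<in> space M. ?m x < \<tau> x} \<in> sets (pre_sigma \<tau>)"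
    using less[OF m assms(2)] mono_pre_sigma[OF m assms(2)] by auto
  also have "{x \<in> space M. ?m x < \<tau> x} = {x \<in> space M. \<sigma> x < \<tau> x}" by auto
  finally show "{x \<in> space M. \<sigma> x < \<tau> x} \<in> sets (pre_sigma \<tau>)" .
qed

lemma pre_sigma_eq:
  assumes "stopping_time F \<sigma>" "stopping_time F \<tau>"
  shows "{x \<in> space M. \<sigma> x = \<tau> x} \<in> sets (pre_sigma \<sigma>)"
proof -
  have "space (pre_sigma \<sigma>) - {x \<in> space M. \<sigma> x < \<tau> x} - {x \<in> space M. \<tau> x < \<sigma> x}
    \<in> sets (pre_sigma \<sigma>)"
    using pre_sigma_less[OF assms] pre_sigma_less[OF assms(2,1)] by blast
  also have "space (pre_sigma \<sigma>) - {x \<in> space M. \<sigma> x < \<tau> x} - {x \<in> space M. \<tau> x < \<sigma> x}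
    = {x \<in> space M. \<sigma> x = \<tau> x}"
    by (auto simp: space_pre_sigma)
  finally show ?thesis .
qed

text \<open>The partition in the definition can be rebuilt from the values: \<open>A k\<close> is where \<open>k\<close> is the first
  index with \<open>\<tau> = \<theta> k\<close>. These sets lie in the right sigma-algebras because
  \<open>\<tau> = \<theta> k \<noteq> \<theta> j\<close> can be decided at time \<open>\<theta> k\<close>. In this form,
  closure under minima, maxima and pasting is immediate.\<close>

lemma \<Theta>_iff:
  "\<tau> \<in> \<Theta> \<longleftrightarrow> stopping_time F \<tau> \<and> (\<forall>x\<in>space M. \<tau> x \<in> {0..T}) \<and>
     (AE x in M. (\<exists>k. \<tau> x = \<theta> k x) \<or> \<tau> x = T)"
proof (intro iffI conjI; (elim conjE)?)
  assume "\<tau> \<in> \<Theta>"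
  then show "stopping_time F \<tau>" "\<forall>x\<in>space M. \<tau> x \<in> {0..T}"
    unfolding \<Theta>_def mem_Collect_eq by simp_all
  from \<open>\<tau> \<in> \<Theta>\<close> obtain A B where "(\<forall>k. A k \<in> sets (pre_sigma (\<theta> k))) \<and> B \<in> sets (F T) \<and>
    disjoint_family A \<and> (\<Union>k. A k) \<inter> B = {} \<and> (\<Union>k. A k) \<union> B = space M \<and>
    (AE x in M. \<tau> x = (\<Sum>k. \<theta> k x * indicator (A k) x) + T * indicator B x)"
    unfolding \<Theta>_def mem_Collect_eq by (elim conjE exE) (rule that, intro conjI)
  then have AB: "disjoint_family A" "(\<Union>k. A k) \<inter> B = {}" "(\<Union>k. A k) \<union> B = space M"
    and eq: "AE x in M. \<tau> x = (\<Sum>k. \<theta> k x * indicator (A k) x) + T * indicator B x"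
    by simp_all
  from eq AE_space show "AE x in M. (\<exists>k. \<tau> x = \<theta> k x) \<or> \<tau> x = T"
  proof eventually_elim
    case (elim x)
    show ?case
    proof (cases "x \<in> B")
      case True
      then have "x \<notin> A k" for k using AB(2) by auto
      then show ?thesis using elim True by simp
    next
      case False
      then obtain k where k: "x \<in> A k" using AB(3) elim(2) by auto
      then have "x \<notin> A j" if "j \<noteq> k" for j
        using AB(1) that by (auto simp: disjoint_family_on_def)
      then have "(\<Sum>j. \<theta> j x * indicator (A j) x) = (\<Sum>j\<in>{k}. \<theta> j x * indicator (A j) x)"
        by (intro suminf_finite) auto
      then show ?thesis using elim False k by auto
    qed
  qed
next
  assume st: "stopping_time F \<tau>" and rng: "\<forall>x\<in>space M. \<tau> x \<in> {0..T}"
    and val: "AE x in M. (\<exists>k. \<tau> x = \<theta> k x) \<or> \<tau> x = T"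
  define A where "A k = {x \<in> space M. \<theta> k x = \<tau> x} - (\<Union>j<k. {x \<in> space M. \<theta> k x = \<theta> j x})" for k
  define B where "B = space M - (\<Union>k. A k)"
  have A: "A k \<in> sets (pre_sigma (\<theta> k))" for k
    unfolding A_def using pre_sigma_eq[OF \<theta>_stopping st] pre_sigma_eq[OF \<theta>_stopping \<theta>_stopping]
    by (intro sets.Diff sets.finite_UN) auto
  have A_T: "A k \<in> sets (F T)" for k
    using A[of k] sets_pre_sigma_subset_F_T[OF \<theta>_stopping[of k]] \<theta>_range[of _ k] by auto
  have "(\<Union>k. A k) \<in> sets (F T)" by (rule sets.countable_UN) (use A_T in blast)
  then have "space (F T) - (\<Union>k. A k) \<in> sets (F T)" by (rule sets.compl_sets)
  then have B: "B \<in> sets (F T)" by (simp add: B_def space_F)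
  have disj_less: "A i \<inter> A j = {}" if "i < j" for i j
  proof (rule equals0I)
    fix x assume x: "x \<in> A i \<inter> A j"
    then have "x \<in> {x \<in> space M. \<theta> j x = \<theta> i x}" by (simp add: A_def)
    moreover have "x \<notin> (\<Union>i<j. {x \<in> space M. \<theta> j x = \<theta> i x})" using x by (simp only: A_def Int_iff Diff_iff simp_thms)
    ultimately show False using that by blast
  qed
  have disj: "disjoint_family A"
    unfolding disjoint_family_on_def using disj_less by (metis Int_commute nat_neq_iff)
  have cover: "\<exists>k. x \<in> A k" if "x \<in> space M" "\<exists>k. \<tau> x = \<theta> k x" for x
  proof -
    define k where "k = (LEAST k. \<tau> x = \<theta> k x)"
    have k: "\<tau> x = \<theta> k x" unfolding k_def using that(2) by (rule LeastI_ex)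
    have less: "\<theta> k x \<noteq> \<theta> j x" if "j < k" for j
      using not_less_Least[OF that[unfolded k_def]] k by simp
    have "x \<in> {x \<in> space M. \<theta> k x = \<tau> x}" using k that(1) by simp
    moreover have "x \<notin> (\<Union>j<k. {x \<in> space M. \<theta> k x = \<theta> j x})" using less by simp
    ultimately show ?thesis unfolding A_def by blast
  qed
  have "AE x in M. \<tau> x = (\<Sum>k. \<theta> k x * indicator (A k) x) + T * indicator B x"
    using val AE_space
  proof eventually_elim
    case (elim x)
    show ?case
    proof (cases "\<exists>k. x \<in> A k")
      case True
      then obtain k where k: "x \<in> A k" by auto
      then have "x \<notin> A j" if "j \<noteq> k" for j
        using disj that by (auto simp: disjoint_family_on_def)
      then have "(\<Sum>j. \<theta> j x * indicator (A j) x) = (\<Sum>j\<in>{k}. \<theta> j x * indicator (A j) x)"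
        by (intro suminf_finite) auto
      moreover have "\<theta> k x = \<tau> x" using k by (simp add: A_def)
      moreover have "x \<notin> B" using k unfolding B_def by blast
      ultimately show ?thesis using k by simp
    next
      case False
      then show ?thesis using cover[OF elim(2)] elim by (auto simp: B_def)
    qed
  qed
  moreover have "(\<Union>k. A k) \<inter> B = {}" "(\<Union>k. A k) \<union> B = space M"
    by (auto simp: A_def B_def)
  ultimately show "\<tau> \<in> \<Theta>" unfolding \<Theta>_def mem_Collect_eq
    using st rng A B disj by (intro conjI exI[of _ A] exI[of _ B] allI)
qed

lemma \<Theta>D:
  assumes "\<tau> \<in> \<Theta>"
  shows "stopping_time F \<tau>" "x \<in> space M \<Longrightarrow> 0 \<le> \<tau> x" "x \<in> space M \<Longrightarrow> \<tau> x \<le> T"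
    "AE x in M. (\<exists>k. \<tau> x = \<theta> k x) \<or> \<tau> x = T"
  using assms by (auto simp: \<Theta>_iff)

lemma pre_sigma_\<Theta>:
  assumes "\<tau> \<in> \<Theta>"
  shows "null_sets M \<subseteq> sets (pre_sigma \<tau>)" "sets (pre_sigma \<tau>) \<subseteq> sets M"
    "space (pre_sigma \<tau>) = space M"
  using null_sets_pre_sigma[of \<tau>] sets_pre_sigma_subset_F_T[of \<tau>] \<Theta>D[OF assms] sets_F[of T]
  by (auto simp: space_pre_sigma)

lemma measurable_pre_sigma_\<Theta>:
  "\<tau> \<in> \<Theta> \<Longrightarrow> f \<in> borel_measurable (pre_sigma \<tau>) \<Longrightarrow> f \<in> borel_measurable M"
  using measurable_mono[of borel borel "pre_sigma \<tau>" M] pre_sigma_\<Theta>[of \<tau>] by auto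

lemma inf_in_\<Theta>:
  assumes "\<sigma> \<in> \<Theta>" "\<tau> \<in> \<Theta>"
  shows "inf \<sigma> \<tau> \<in> \<Theta>"
proof -
  have inf_eq: "inf \<sigma> \<tau> = (\<lambda>x. min (\<sigma> x) (\<tau> x))" by (auto simp: inf_min)
  have "AE x in M. (\<exists>k. min (\<sigma> x) (\<tau> x) = \<theta> k x) \<or> min (\<sigma> x) (\<tau> x) = T"
    using \<Theta>D(4)[OF assms(1)] \<Theta>D(4)[OF assms(2)] by eventually_elim (auto simp: min_def)
  then show ?thesis
    using assms unfolding inf_eq \<Theta>_iff by (auto intro: stopping_time_min)
qed

lemma tuple_max_less_eq_iff: "1 \<le> d \<Longrightarrow> tuple_max d \<tau> x \<le> t \<longleftrightarrow> (\<forall>i\<in>{1..d}. \<tau> i x \<le> t)"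
  by (simp add: tuple_max_def)

lemma tuple_min_less_eq_iff: "1 \<le> d \<Longrightarrow> tuple_min d \<tau> x \<le> t \<longleftrightarrow> (\<exists>i\<in>{1..d}. \<tau> i x \<le> t)"
  by (subst tuple_min_def, subst Min_le_iff) auto

lemma tuple_max_attained: "1 \<le> d \<Longrightarrow> \<exists>i\<in>{1..d}. tuple_max d \<tau> x = \<tau> i x"
  unfolding tuple_max_def using Max_in[of "(\<lambda>i. \<tau> i x) ` {1..d}"] by fastforce

lemma tuple_min_attained: "1 \<le> d \<Longrightarrow> \<exists>i\<in>{1..d}. tuple_min d \<tau> x = \<tau> i x"
  unfolding tuple_min_def using Min_in[of "(\<lambda>i. \<tau> i x) ` {1..d}"] by fastforce

lemma tuple_min_le: "i \<in> {1..d} \<Longrightarrow> tuple_min d \<tau> x \<le> \<tau> i x"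
  by (auto simp: tuple_min_def intro!: Min_le)

text \<open>Maxima and minima of tuples both take, at each point, the value of one of the components.\<close>

lemma \<Theta>_attained:
  fixes d :: nat
  assumes \<tau>: "\<And>i. i \<in> {1..d} \<Longrightarrow> \<tau> i \<in> \<Theta>" and att: "\<And>x. \<exists>i\<in>{1..d}. \<nu> x = \<tau> i x"
    and "stopping_time F \<nu>"
  shows "\<nu> \<in> \<Theta>"
proof -
  have "AE x in M. \<forall>i\<in>{1..d}. (\<exists>k. \<tau> i x = \<theta> k x) \<or> \<tau> i x = T"
    by (intro AE_finite_allI \<Theta>D(4) \<tau>) auto
  then have "AE x in M. (\<exists>k. \<nu> x = \<theta> k x) \<or> \<nu> x = T"
  proof eventually_elim
    case (elim x)
    then show ?case using att[of x] by metis
  qed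
  moreover have "\<nu> x \<in> {0..T}" if "x \<in> space M" for x
    using att[of x] \<Theta>D(2,3)[OF \<tau> that] by force
  ultimately show ?thesis using assms(3) by (auto simp: \<Theta>_iff)
qed

lemma tuple_max_in_\<Theta>:
  assumes "1 \<le> d" "\<And>i. i \<in> {1..d} \<Longrightarrow> \<tau> i \<in> \<Theta>"
  shows "tuple_max d \<tau> \<in> \<Theta>"
proof (rule \<Theta>_attained[of d \<tau> "tuple_max d \<tau>", OF _ tuple_max_attained[OF assms(1)]])
  show "stopping_time F (tuple_max d \<tau>)"
    unfolding stopping_time_def tuple_max_less_eq_iff[OF assms(1)]
    by (intro allI pred_intros_finite stopping_timeD \<Theta>D(1) assms(2)) auto
qed (rule assms(2))

lemma tuple_min_in_\<Theta>:
  assumes "1 \<le> d" "\<And>i. i \<in> {1..d} \<Longrightarrow> \<tau> i \<in> \<Theta>"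
  shows "tuple_min d \<tau> \<in> \<Theta>"
proof (rule \<Theta>_attained[of d \<tau> "tuple_min d \<tau>", OF _ tuple_min_attained[OF assms(1)]])
  show "stopping_time F (tuple_min d \<tau>)"
    unfolding stopping_time_def tuple_min_less_eq_iff[OF assms(1)]
    by (intro allI pred_intros_finite stopping_timeD \<Theta>D(1) assms(2)) auto
qed (rule assms(2))

definition paste :: "'a set \<Rightarrow> ('a \<Rightarrow> real) \<Rightarrow> ('a \<Rightarrow> real) \<Rightarrow> 'a \<Rightarrow> real" where
  "paste A \<sigma> \<tau> = (\<lambda>x. if x \<in> A then \<sigma> x else \<tau> x)"

lemma \<Theta>_fromI: "\<tau> \<in> \<Theta> \<Longrightarrow> AE x in M. S x \<le> \<tau> x \<Longrightarrow> \<tau> \<in> \<Theta>_from S"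
  by (simp add: \<Theta>_from_def)

lemma \<Theta>_fromD: "\<tau> \<in> \<Theta>_from S \<Longrightarrow> \<tau> \<in> \<Theta>" "\<tau> \<in> \<Theta>_from S \<Longrightarrow> AE x in M. S x \<le> \<tau> x"
  by (simp_all add: \<Theta>_from_def)

lemma self_in_\<Theta>_from: "S \<in> \<Theta> \<Longrightarrow> S \<in> \<Theta>_from S"
  by (simp add: \<Theta>_from_def)

lemma \<Theta>_from_trans: "\<tau> \<in> \<Theta>_from \<nu> \<Longrightarrow> \<nu> \<in> \<Theta>_from S \<Longrightarrow> \<tau> \<in> \<Theta>_from S"
proof (rule \<Theta>_fromI)
  assume "\<tau> \<in> \<Theta>_from \<nu>" "\<nu> \<in> \<Theta>_from S"
  from this[THEN \<Theta>_fromD(2)] show "AE x in M. S x \<le> \<tau> x" by eventually_elim simp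
qed (rule \<Theta>_fromD(1))

text \<open>Deciding at time \<open>S\<close> which of two later times to use is again a Bermudan strategy. The times exceed
  \<open>S\<close> only almost surely, so the event \<open>{paste A \<sigma> \<tau> \<le> t}\<close> is compared with an
  event of \<open>F t\<close> up to a null set.\<close>

lemma paste_in_\<Theta>_from:
  assumes S: "S \<in> \<Theta>" and A: "A \<in> sets (pre_sigma S)"
    and \<sigma>: "\<sigma> \<in> \<Theta>_from S" and \<tau>: "\<tau> \<in> \<Theta>_from S"
  shows "paste A \<sigma> \<tau> \<in> \<Theta>_from S"
proof (rule \<Theta>_fromI)
  note [simp] = paste_def
  note \<sigma>' = \<Theta>_fromD(1)[OF \<sigma>] and \<tau>' = \<Theta>_fromD(1)[OF \<tau>]
  have A_M: "A \<subseteq> space M"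
    using sets.sets_into_space[OF A] by (simp add: space_pre_sigma)
  show "AE x in M. S x \<le> paste A \<sigma> \<tau> x"
    using \<Theta>_fromD(2)[OF \<sigma>] \<Theta>_fromD(2)[OF \<tau>] by eventually_elim simp
  have stop: "stopping_time F (paste A \<sigma> \<tau>)"
  proof (rule stopping_timeI, unfold pred_def space_F)
    fix t
    show "{x \<in> space M. paste A \<sigma> \<tau> x \<le> t} \<in> sets (F t)"
    proof (cases "0 \<le> t")
      case True
      let ?B = "({x \<in> A. S x \<le> t} \<inter> {x \<in> space M. \<sigma> x \<le> t}) \<union>
        ({x \<in> space M - A. S x \<le> t} \<inter> {x \<in> space M. \<tau> x \<le> t})"
      have "space (pre_sigma S) - A \<in> sets (pre_sigma S)" using A by blast
      then have "space M - A \<in> sets (pre_sigma S)" by (simp add: space_pre_sigma)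
      moreover have "{x \<in> space M. \<nu> x \<le> t} \<in> sets (F t)" if "\<nu> \<in> \<Theta>" for \<nu>
        using stopping_timeD[OF \<Theta>D(1)[OF that], of t] by (simp add: pred_def space_F)
      ultimately have B: "?B \<in> sets (F t)"
        using sets_pre_sigmaD[OF \<Theta>D(1)[OF S]] A \<sigma>' \<tau>' by (intro sets.Un sets.Int)
      have "AE x in M. x \<in> ?B \<longleftrightarrow> x \<in> {x \<in> space M. paste A \<sigma> \<tau> x \<le> t}"
        using \<Theta>_fromD(2)[OF \<sigma>] \<Theta>_fromD(2)[OF \<tau>] by eventually_elim (use A_M in auto)
      moreover have "null_sets M \<subseteq> sets (F t)" using F_complete sets_F_mono[OF True] by blast
      ultimately show ?thesis by (intro sets_AE_cong[OF _ sets_F B]) auto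
    next
      case False
      then have "{x \<in> space M. paste A \<sigma> \<tau> x \<le> t} = {}"
        using \<Theta>D(2)[OF \<sigma>'] \<Theta>D(2)[OF \<tau>'] by force
      then show ?thesis by (metis sets.empty_sets)
    qed
  qed
  have "AE x in M. (\<exists>k. paste A \<sigma> \<tau> x = \<theta> k x) \<or> paste A \<sigma> \<tau> x = T"
    using \<Theta>D(4)[OF \<sigma>'] \<Theta>D(4)[OF \<tau>'] by eventually_elim simp
  with stop show "paste A \<sigma> \<tau> \<in> \<Theta>"
    using \<Theta>D(2,3)[OF \<sigma>'] \<Theta>D(2,3)[OF \<tau>'] by (auto simp: \<Theta>_iff)
qed

lemma tuple_from:
  assumes "1 \<le> d" "\<And>i. i \<in> {1..d} \<Longrightarrow> \<tau> i \<in> \<Theta>_from S"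
  shows "tuple_max d \<tau> \<in> \<Theta>_from S" "tuple_min d \<tau> \<in> \<Theta>_from S"
    "tuple_max d \<tau> \<in> \<Theta>_from (tuple_min d \<tau>)"
proof -
  have \<tau>: "\<tau> i \<in> \<Theta>" if "i \<in> {1..d}" for i using assms(2)[OF that] by (rule \<Theta>_fromD)
  note \<Theta> = tuple_max_in_\<Theta>[OF assms(1) \<tau>] tuple_min_in_\<Theta>[OF assms(1) \<tau>]
  have S: "AE x in M. \<forall>i\<in>{1..d}. S x \<le> \<tau> i x"
    by (intro AE_finite_allI \<Theta>_fromD(2) assms(2)) auto
  have "AE x in M. S x \<le> tuple_max d \<tau> x" using S
  proof eventually_elim
    case (elim x)
    with tuple_max_attained[OF assms(1), of \<tau> x] show ?case by auto
  qed
  then show "tuple_max d \<tau> \<in> \<Theta>_from S" using \<Theta> by (intro \<Theta>_fromI)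
  have "AE x in M. S x \<le> tuple_min d \<tau> x" using S
  proof eventually_elim
    case (elim x)
    with tuple_min_attained[OF assms(1), of \<tau> x] show ?case by auto
  qed
  then show "tuple_min d \<tau> \<in> \<Theta>_from S" using \<Theta> by (intro \<Theta>_fromI)
  have "tuple_min d \<tau> x \<le> tuple_max d \<tau> x" for x
    using tuple_max_attained[OF assms(1), of \<tau> x] tuple_min_le by metis
  then show "tuple_max d \<tau> \<in> \<Theta>_from (tuple_min d \<tau>)" using \<Theta> by (intro \<Theta>_fromI) auto
qed

end

section \<open>Locality and directedness of rewards\<close>

context bermudan_operators
begin

lemma \<rho>_AE_cong:
  assumes "S \<in> \<Theta>" "\<tau> \<in> \<Theta>" "\<eta>1 \<in> Lp_space M p (pre_sigma \<tau>)" "\<eta>2 \<in> Lp_space M p (pre_sigma \<tau>)"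
    and eq: "AE x in M. \<eta>1 x = \<eta>2 x"
  shows "AE x in M. \<rho> S \<tau> \<eta>1 x = \<rho> S \<tau> \<eta>2 x"
proof -
  have "AE x in M. \<eta>1 x \<le> \<eta>2 x" using eq by eventually_elim simp
  moreover have "AE x in M. \<eta>2 x \<le> \<eta>1 x" using eq by eventually_elim simp
  ultimately have "AE x in M. \<rho> S \<tau> \<eta>1 x \<le> \<rho> S \<tau> \<eta>2 x" "AE x in M. \<rho> S \<tau> \<eta>2 x \<le> \<rho> S \<tau> \<eta>1 x"
    using assms(1-4) by (simp_all add: \<rho>_mono)
  then show ?thesis by eventually_elim simp
qed

end

locale multiple_stopping = bermudan_operators M F T \<theta> p \<rho>
  for M :: "'a measure" and F T \<theta> p \<rho> +
  fixes d :: nat and \<psi> :: "(nat \<Rightarrow> 'a \<Rightarrow> real) \<Rightarrow> 'a \<Rightarrow> real"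
  assumes d: "1 \<le> d" and adm: "d_admissible d \<psi>" and int: "d_p_integrable p d \<psi>"
begin

abbreviation reward :: "('a \<Rightarrow> real) \<Rightarrow> (nat \<Rightarrow> 'a \<Rightarrow> real) \<Rightarrow> 'a \<Rightarrow> real" where
  "reward S \<tau> \<equiv> \<rho> S (tuple_max d \<tau>) (\<psi> \<tau>)"

abbreviation tuples_from :: "('a \<Rightarrow> real) \<Rightarrow> (nat \<Rightarrow> 'a \<Rightarrow> real) set" where
  "tuples_from S \<equiv> {1..d} \<rightarrow>\<^sub>E \<Theta>_from S"

lemma tuples_fromD:
  assumes "\<tau> \<in> tuples_from S"
  shows "\<tau> \<in> {1..d} \<rightarrow>\<^sub>E \<Theta>" "i \<in> {1..d} \<Longrightarrow> \<tau> i \<in> \<Theta>_from S" "i \<in> {1..d} \<Longrightarrow> \<tau> i \<in> \<Theta>"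
    "tuple_max d \<tau> \<in> \<Theta>_from S" "tuple_min d \<tau> \<in> \<Theta>_from S"
    "tuple_max d \<tau> \<in> \<Theta>_from (tuple_min d \<tau>)"
proof -
  show i: "\<tau> i \<in> \<Theta>_from S" if "i \<in> {1..d}" for i by (rule PiE_mem[OF assms that])
  then show "i \<in> {1..d} \<Longrightarrow> \<tau> i \<in> \<Theta>" by (rule \<Theta>_fromD(1))
  show "\<tau> \<in> {1..d} \<rightarrow>\<^sub>E \<Theta>"
    using assms \<Theta>_fromD(1) unfolding PiE_iff by blast
  show "tuple_max d \<tau> \<in> \<Theta>_from S" by (rule tuple_from(1)[of d \<tau> S]) (rule d i, assumption?)+
  show "tuple_min d \<tau> \<in> \<Theta>_from S" by (rule tuple_from(2)[of d \<tau> S]) (rule d i, assumption?)+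
  show "tuple_max d \<tau> \<in> \<Theta>_from (tuple_min d \<tau>)"
    by (rule tuple_from(3)[of d \<tau> S]) (rule d i, assumption?)+
qed

lemma \<psi>_cong:
  assumes "\<tau> \<in> {1..d} \<rightarrow>\<^sub>E \<Theta>" "\<tau>' \<in> {1..d} \<rightarrow>\<^sub>E \<Theta>"
  shows "AE x in M. (\<forall>i\<in>{1..d}. \<tau> i x = \<tau>' i x) \<longrightarrow> \<psi> \<tau> x = \<psi> \<tau>' x"
  by (rule bspec[OF bspec[OF conjunct2[OF adm[unfolded d_admissible_def]] assms(1)] assms(2)])

lemma \<psi>_Lp:
  assumes "\<tau> \<in> {1..d} \<rightarrow>\<^sub>E \<Theta>"
  shows "\<psi> \<tau> \<in> Lp_space M p (pre_sigma (tuple_max d \<tau>))"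
proof (rule Lp_space_change_algebra)
  show "\<psi> \<tau> \<in> Lp_space M p M" using int assms unfolding d_p_integrable_def by blast
  show "\<psi> \<tau> \<in> borel_measurable (pre_sigma (tuple_max d \<tau>))"
    using adm assms unfolding d_admissible_def by blast
qed

lemma reward_Lp:
  assumes "S \<in> \<Theta>" "\<tau> \<in> tuples_from S"
  shows "reward S \<tau> \<in> Lp_space M p (pre_sigma S)"
  by (rule \<rho>_Lp[OF assms(1) \<Theta>_fromD(1)[OF tuples_fromD(4)[OF assms(2)]]
        \<psi>_Lp[OF tuples_fromD(1)[OF assms(2)]]])

text \<open>Stopping every component at \<open>\<kappa>\<close> turns the reward of the fixed tuple \<open>\<sigma>\<close> into a
  family indexed by a single time, which the zero-one law can be applied to. Its value at the
  maximum of the tuple is the original reward.\<close>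

definition freeze :: "(nat \<Rightarrow> 'a \<Rightarrow> real) \<Rightarrow> ('a \<Rightarrow> real) \<Rightarrow> nat \<Rightarrow> 'a \<Rightarrow> real" where
  "freeze \<sigma> \<kappa> = (\<lambda>i\<in>{1..d}. inf (\<sigma> i) \<kappa>)"

lemma freeze_in_tuples:
  assumes \<sigma>: "\<sigma> \<in> {1..d} \<rightarrow>\<^sub>E \<Theta>" and \<kappa>: "\<kappa> \<in> \<Theta>"
  shows "freeze \<sigma> \<kappa> \<in> {1..d} \<rightarrow>\<^sub>E \<Theta>"
  unfolding freeze_def restrict_PiE_iff by (intro ballI inf_in_\<Theta> \<kappa>) (rule PiE_mem[OF \<sigma>])

lemma freeze_Lp:
  assumes "\<sigma> \<in> {1..d} \<rightarrow>\<^sub>E \<Theta>" "\<kappa> \<in> \<Theta>"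
  shows "\<psi> (freeze \<sigma> \<kappa>) \<in> Lp_space M p (pre_sigma \<kappa>)"
proof -
  note fr = freeze_in_tuples[OF assms]
  have max: "tuple_max d (freeze \<sigma> \<kappa>) \<in> \<Theta>"
    by (rule tuple_max_in_\<Theta>[OF d]) (rule PiE_mem[OF fr])
  have "tuple_max d (freeze \<sigma> \<kappa>) x \<le> \<kappa> x" for x
    by (auto simp: tuple_max_less_eq_iff[OF d] freeze_def)
  then have "sets (pre_sigma (tuple_max d (freeze \<sigma> \<kappa>))) \<subseteq> sets (pre_sigma \<kappa>)"
    using mono_pre_sigma \<Theta>D(1) max assms(2) by blast
  then have "borel_measurable (pre_sigma (tuple_max d (freeze \<sigma> \<kappa>))) \<subseteq> borel_measurable (pre_sigma \<kappa>)"
    by (intro measurable_mono) (auto simp: space_pre_sigma)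
  moreover have "\<psi> (freeze \<sigma> \<kappa>) \<in> borel_measurable (pre_sigma (tuple_max d (freeze \<sigma> \<kappa>)))"
    using \<psi>_Lp[OF fr] by (simp add: Lp_space_def)
  ultimately show ?thesis by (intro Lp_space_change_algebra[OF \<psi>_Lp[OF fr]]) blast
qed

lemma freeze_family:
  assumes \<sigma>: "\<sigma> \<in> {1..d} \<rightarrow>\<^sub>E \<Theta>"
  shows "admissible (\<lambda>\<kappa>. \<psi> (freeze \<sigma> \<kappa>))" "p_integrable p (\<lambda>\<kappa>. \<psi> (freeze \<sigma> \<kappa>))"
proof -
  have "AE x in M. \<kappa> x = \<kappa>' x \<longrightarrow> \<psi> (freeze \<sigma> \<kappa>) x = \<psi> (freeze \<sigma> \<kappa>') x"
    if "\<kappa> \<in> \<Theta>" "\<kappa>' \<in> \<Theta>" for \<kappa> \<kappa>'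
  proof -
    have "AE x in M. (\<forall>i\<in>{1..d}. freeze \<sigma> \<kappa> i x = freeze \<sigma> \<kappa>' i x) \<longrightarrow>
        \<psi> (freeze \<sigma> \<kappa>) x = \<psi> (freeze \<sigma> \<kappa>') x"
      by (rule \<psi>_cong) (rule freeze_in_tuples[OF \<sigma>] that)+
    then show ?thesis by eventually_elim (simp add: freeze_def)
  qed
  then show "admissible (\<lambda>\<kappa>. \<psi> (freeze \<sigma> \<kappa>))"
    using freeze_Lp[OF \<sigma>] unfolding admissible_def Lp_space_def by blast
  show "p_integrable p (\<lambda>\<kappa>. \<psi> (freeze \<sigma> \<kappa>))"
    using int freeze_in_tuples[OF \<sigma>] unfolding p_integrable_def d_p_integrable_def by blast
qed

lemma freeze_tuple_max:
  assumes \<sigma>: "\<sigma> \<in> {1..d} \<rightarrow>\<^sub>E \<Theta>"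
  shows "freeze \<sigma> (tuple_max d \<sigma>) = \<sigma>"
proof
  fix i
  show "freeze \<sigma> (tuple_max d \<sigma>) i = \<sigma> i"
  proof (cases "i \<in> {1..d}")
    case True
    then have "\<sigma> i x \<le> tuple_max d \<sigma> x" for x
      using tuple_max_less_eq_iff[OF d, of \<sigma> x "tuple_max d \<sigma> x"] by blast
    then show ?thesis using True by (simp add: freeze_def inf_absorb1 le_fun_def)
  next
    case False
    then have "freeze \<sigma> (tuple_max d \<sigma>) i = undefined" by (simp only: freeze_def restrict_apply if_False)
    then show ?thesis using PiE_arb[OF \<sigma> False] by simp
  qed
qed

text \<open>An operator \<open>\<rho> S \<tau>\<close> may couple what happens on \<open>A\<close> with the values of its
  argument outside \<open>A\<close>, so it does not suffice that the two terminal rewards agree on \<open>A\<close>.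
  The zero-one law allows the time to be changed outside \<open>A\<close>: let it be \<open>S\<close> there.
  The frozen tuples of \<open>\<sigma>\<close> and \<open>\<nu>\<close> at this pasted time then agree everywhere, on \<open>A\<close> by
  hypothesis and outside because all components have been cut back to \<open>S\<close>.\<close>

lemma reward_local:
  assumes S: "S \<in> \<Theta>" and A: "A \<in> sets (pre_sigma S)"
    and \<sigma>: "\<sigma> \<in> tuples_from S" and \<nu>: "\<nu> \<in> tuples_from S"
    and eq: "\<And>i. i \<in> {1..d} \<Longrightarrow> AE x in M. x \<in> A \<longrightarrow> \<sigma> i x = \<nu> i x"
  shows "AE x in M. x \<in> A \<longrightarrow> reward S \<sigma> x = reward S \<nu> x"
proof -
  \<comment> \<open>On \<open>A\<close> this is also the maximum of \<open>\<nu>\<close>, so both rewards can be moved to it.\<close>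
  let ?m = "paste A (tuple_max d \<sigma>) S"
  note \<sigma>\<Theta> = tuples_fromD(1)[OF \<sigma>] and \<nu>\<Theta> = tuples_fromD(1)[OF \<nu>]
  have m: "?m \<in> \<Theta>_from S"
    by (rule paste_in_\<Theta>_from[OF S A tuples_fromD(4)[OF \<sigma>] self_in_\<Theta>_from[OF S]])
  have eq': "AE x in M. \<forall>i\<in>{1..d}. x \<in> A \<longrightarrow> \<sigma> i x = \<nu> i x"
    by (intro AE_finite_allI eq) auto
  have move: "AE x in M. indicator A x * reward S \<tau> x = indicator A x * \<rho> S ?m (\<psi> (freeze \<tau> ?m)) x"
    if \<tau>: "\<tau> \<in> tuples_from S" and "AE x in M. x \<in> A \<longrightarrow> tuple_max d \<tau> x = ?m x" for \<tau>
    using \<rho>_zero_one[OF freeze_family[OF tuples_fromD(1)[OF \<tau>]] S A tuples_fromD(4)[OF \<tau>] m that(2)]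
    by (simp add: freeze_tuple_max[OF tuples_fromD(1)[OF \<tau>]])
  have "AE x in M. \<forall>i\<in>{1..d}. S x \<le> \<sigma> i x"
    by (intro AE_finite_allI \<Theta>_fromD(2) tuples_fromD(2)[OF \<sigma>]) auto
  moreover have "AE x in M. \<forall>i\<in>{1..d}. S x \<le> \<nu> i x"
    by (intro AE_finite_allI \<Theta>_fromD(2) tuples_fromD(2)[OF \<nu>]) auto
  ultimately have "AE x in M. \<forall>i\<in>{1..d}. freeze \<sigma> ?m i x = freeze \<nu> ?m i x"
    using eq' by eventually_elim (auto simp: freeze_def paste_def inf_absorb2)
  moreover have "AE x in M. (\<forall>i\<in>{1..d}. freeze \<sigma> ?m i x = freeze \<nu> ?m i x) \<longrightarrow>
      \<psi> (freeze \<sigma> ?m) x = \<psi> (freeze \<nu> ?m) x"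
    by (rule \<psi>_cong) (rule freeze_in_tuples \<sigma>\<Theta> \<nu>\<Theta> \<Theta>_fromD(1)[OF m])+
  ultimately have "AE x in M. \<psi> (freeze \<sigma> ?m) x = \<psi> (freeze \<nu> ?m) x"
    by eventually_elim simp
  then have same: "AE x in M. \<rho> S ?m (\<psi> (freeze \<sigma> ?m)) x = \<rho> S ?m (\<psi> (freeze \<nu> ?m)) x"
    by (intro \<rho>_AE_cong S \<Theta>_fromD(1)[OF m] freeze_Lp \<sigma>\<Theta> \<nu>\<Theta>)
  have "AE x in M. x \<in> A \<longrightarrow> tuple_max d \<nu> x = ?m x"
    using eq' by eventually_elim (auto simp: paste_def tuple_max_def)
  note move_\<nu> = move[OF \<nu> this]
  have "AE x in M. x \<in> A \<longrightarrow> tuple_max d \<sigma> x = ?m x" by (simp add: paste_def)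
  from move[OF \<sigma> this] move_\<nu> same show ?thesis by eventually_elim auto
qed

text \<open>Use the better of the two tuples, selected by an event known at time \<open>S\<close>. By locality the pasted
  tuple earns on each part what the selected tuple earns.\<close>

lemma reward_directed:
  assumes S: "S \<in> \<Theta>" and \<sigma>: "\<sigma> \<in> tuples_from S" and \<nu>: "\<nu> \<in> tuples_from S"
  shows "\<exists>\<tau>\<in>tuples_from S. (AE x in M. reward S \<sigma> x \<le> reward S \<tau> x) \<and>
    (AE x in M. reward S \<nu> x \<le> reward S \<tau> x)"
proof -
  define A where "A = {x \<in> space (pre_sigma S). reward S \<nu> x \<le> reward S \<sigma> x}"
  have [measurable]: "reward S \<sigma> \<in> borel_measurable (pre_sigma S)"
    "reward S \<nu> \<in> borel_measurable (pre_sigma S)"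
    using reward_Lp[OF S \<sigma>] reward_Lp[OF S \<nu>] by (simp_all add: Lp_space_def)
  have A: "A \<in> sets (pre_sigma S)" unfolding A_def by measurable
  have A': "space (pre_sigma S) - A \<in> sets (pre_sigma S)" using A by (rule sets.compl_sets)
  define \<tau> where "\<tau> = (\<lambda>i\<in>{1..d}. paste A (\<sigma> i) (\<nu> i))"
  have \<tau>: "\<tau> \<in> tuples_from S"
    unfolding \<tau>_def using tuples_fromD(2)[OF \<sigma>] tuples_fromD(2)[OF \<nu>]
    by (intro restrict_PiE_iff[THEN iffD2] ballI paste_in_\<Theta>_from[OF S A])
  have "AE x in M. x \<in> A \<longrightarrow> reward S \<sigma> x = reward S \<tau> x"
    by (rule reward_local[OF S A \<sigma> \<tau>]) (auto simp: \<tau>_def paste_def)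
  moreover have "AE x in M. x \<in> space (pre_sigma S) - A \<longrightarrow> reward S \<nu> x = reward S \<tau> x"
    by (rule reward_local[OF S A' \<nu> \<tau>]) (auto simp: \<tau>_def paste_def)
  ultimately have "AE x in M. reward S \<sigma> x \<le> reward S \<tau> x \<and> reward S \<nu> x \<le> reward S \<tau> x"
    using AE_space
  proof eventually_elim
    case (elim x)
    then show ?case by (cases "x \<in> A") (auto simp: A_def space_pre_sigma)
  qed
  then show ?thesis using \<tau> by (intro bexI[of _ \<tau>]) auto
qed

lemma const_in_tuples: "S \<in> \<Theta> \<Longrightarrow> (\<lambda>i\<in>{1..d}. S) \<in> tuples_from S"
  by (simp add: restrict_PiE_iff self_in_\<Theta>_from)

lemma tuples_from_mono:
  "\<nu> \<in> \<Theta>_from S \<Longrightarrow> \<tau> \<in> tuples_from \<nu> \<Longrightarrow> \<tau> \<in> tuples_from S"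
  by (rule subsetD[OF PiE_mono]) (auto intro: \<Theta>_from_trans)

lemma reward_measurable:
  assumes "S \<in> \<Theta>" "\<tau> \<in> tuples_from S"
  shows "(\<lambda>x. ereal (reward S \<tau> x)) \<in> borel_measurable (pre_sigma S)"
proof -
  have "reward S \<tau> \<in> borel_measurable (pre_sigma S)"
    using reward_Lp[OF assms] unfolding Lp_space_def by blast
  then show ?thesis by measurable
qed

lemma V_measurable:
  assumes S: "S \<in> \<Theta>"
  shows "V d \<psi> S \<in> borel_measurable (pre_sigma S)"
  unfolding V_def
  by (rule ess_sup_measurable_subalgebra[OF finite_measure_axioms pre_sigma_\<Theta>[OF S]])
     (use reward_measurable[OF S] const_in_tuples[OF S] in blast)+

lemma V_is_ess_sup:
  assumes S: "S \<in> \<Theta>"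
  shows "is_ess_sup M (tuples_from S) (\<lambda>\<tau> x. ereal (reward S \<tau> x)) (V d \<psi> S)"
  unfolding V_def
  by (rule is_ess_sup_ess_sup) (rule measurable_pre_sigma_\<Theta>[OF S reward_measurable[OF S]])

lemma reward_le_V:
  "S \<in> \<Theta> \<Longrightarrow> \<tau> \<in> tuples_from S \<Longrightarrow> AE x in M. ereal (reward S \<tau> x) \<le> V d \<psi> S x"
  using V_is_ess_sup by (simp add: is_ess_sup_def)

lemma reward_consistent:
  assumes S: "S \<in> \<Theta>" and \<nu>: "\<nu> \<in> \<Theta>_from S" and \<tau>: "\<tau> \<in> tuples_from \<nu>"
  shows "AE x in M. \<rho> S \<nu> (reward \<nu> \<tau>) x = reward S \<tau> x"
  by (rule \<rho>_consistency[OF S \<nu> tuples_fromD(4)[OF \<tau>] \<psi>_Lp[OF tuples_fromD(1)[OF \<tau>]]])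

end

section \<open>The value function is a supermartingale\<close>

locale integrable_multiple_stopping = multiple_stopping M F T \<theta> p \<rho> d \<psi>
  for M :: "'a measure" and F T \<theta> p \<rho> d \<psi> +
  assumes V_int: "\<And>S. S \<in> \<Theta> \<Longrightarrow> (AE x in M. \<bar>V d \<psi> S x\<bar> \<noteq> \<infinity>) \<and>
      (\<lambda>x. real_of_ereal (V d \<psi> S x)) \<in> Lp_space M p M"
    and dprop: "d_property d"
begin

lemma V_real:
  assumes S: "S \<in> \<Theta>"
  shows "AE x in M. ereal (real_of_ereal (V d \<psi> S x)) = V d \<psi> S x"
    and "(\<lambda>x. real_of_ereal (V d \<psi> S x)) \<in> Lp_space M p (pre_sigma S)"
proof -
  have "AE x in M. \<bar>V d \<psi> S x\<bar> \<noteq> \<infinity>" using V_int[OF S] by (rule conjunct1)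
  then show "AE x in M. ereal (real_of_ereal (V d \<psi> S x)) = V d \<psi> S x"
    by eventually_elim (simp add: ereal_real)
  have "(\<lambda>x. real_of_ereal (V d \<psi> S x)) \<in> Lp_space M p M" using V_int[OF S] by (rule conjunct2)
  then show "(\<lambda>x. real_of_ereal (V d \<psi> S x)) \<in> Lp_space M p (pre_sigma S)"
    by (rule Lp_space_change_algebra) (rule borel_measurable_real_of_ereal[OF V_measurable[OF S]])
qed

text \<open>The supermartingale property of the value function. By directedness \<open>V \<tau>\<close> is the limit of
  an increasing sequence of rewards seen from \<open>\<tau>\<close>. Consistency turns their images under
  \<open>\<rho> S \<tau>\<close> into rewards seen from \<open>S\<close>, and the Fatou property passes to the limit.\<close>

lemma \<rho>_V_le_V:
  assumes S: "S \<in> \<Theta>" and \<tau>: "\<tau> \<in> \<Theta>_from S"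
  shows "AE x in M. ereal (\<rho> S \<tau> (\<lambda>y. real_of_ereal (V d \<psi> \<tau> y)) x) \<le> V d \<psi> S x"
proof -
  have \<tau>\<Theta>: "\<tau> \<in> \<Theta>" using \<tau> by (rule \<Theta>_fromD)
  have "\<exists>s. (\<forall>n::nat. s n \<in> tuples_from \<tau>) \<and>
    (AE x in M. incseq (\<lambda>n. ereal (reward \<tau> (s n) x))) \<and>
    (AE x in M. (\<lambda>n. ereal (reward \<tau> (s n) x)) \<longlonglongrightarrow> V d \<psi> \<tau> x)"
    unfolding V_def
  proof (rule ess_sup_directed)
    show "(\<lambda>x. ereal (reward \<tau> \<sigma> x)) \<in> borel_measurable M" if "\<sigma> \<in> tuples_from \<tau>" for \<sigma>
      by (rule measurable_pre_sigma_\<Theta>[OF \<tau>\<Theta> reward_measurable[OF \<tau>\<Theta> that]])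
    show "tuples_from \<tau> \<noteq> {}" using const_in_tuples[OF \<tau>\<Theta>] by (metis empty_iff)
    show "\<exists>\<kappa>\<in>tuples_from \<tau>. (AE x in M. ereal (reward \<tau> \<sigma> x) \<le> ereal (reward \<tau> \<kappa> x)) \<and>
        (AE x in M. ereal (reward \<tau> \<nu> x) \<le> ereal (reward \<tau> \<kappa> x))"
      if "\<sigma> \<in> tuples_from \<tau>" "\<nu> \<in> tuples_from \<tau>" for \<sigma> \<nu>
      unfolding ereal_less_eq by (rule reward_directed[OF \<tau>\<Theta> that])
  qed
  then obtain s where s_all: "\<forall>n::nat. s n \<in> tuples_from \<tau>"
    and inc: "AE x in M. incseq (\<lambda>n. ereal (reward \<tau> (s n) x))"
    and lim: "AE x in M. (\<lambda>n. ereal (reward \<tau> (s n) x)) \<longlonglongrightarrow> V d \<psi> \<tau> x"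
    by (elim exE conjE)
  have s: "s n \<in> tuples_from \<tau>" for n using s_all by (rule spec)
  have "AE x in M. ereal (\<rho> S \<tau> (\<lambda>y. real_of_ereal (V d \<psi> \<tau> y)) x)
      \<le> liminf (\<lambda>n. ereal (\<rho> S \<tau> (reward \<tau> (s n)) x))"
  proof (rule \<rho>_Fatou[OF S \<tau>\<Theta> reward_Lp[OF \<tau>\<Theta> s] _ V_real(2)[OF \<tau>\<Theta>]])
    show "AE x in M. reward \<tau> (s n) x \<le> reward \<tau> (s (Suc n)) x" for n
      using inc by eventually_elim (simp add: incseq_Suc_iff)
    show "AE x in M. (\<lambda>n. reward \<tau> (s n) x) \<longlonglongrightarrow> real_of_ereal (V d \<psi> \<tau> x)"
      using lim V_real(1)[OF \<tau>\<Theta>]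
    proof eventually_elim
      case (elim x)
      then show ?case by (metis lim_ereal)
    qed
  qed
  moreover have "AE x in M. \<forall>n. ereal (\<rho> S \<tau> (reward \<tau> (s n)) x) \<le> V d \<psi> S x"
  proof (rule AE_all_countable[THEN iffD2, rule_format])
    fix n
    show "AE x in M. ereal (\<rho> S \<tau> (reward \<tau> (s n)) x) \<le> V d \<psi> S x"
      using reward_consistent[OF S \<tau> s, of n]
        reward_le_V[OF S tuples_from_mono[OF \<tau> s], of n]
      by eventually_elim simp
  qed
  ultimately show ?thesis
  proof eventually_elim
    case (elim x)
    have "liminf (\<lambda>n. ereal (\<rho> S \<tau> (reward \<tau> (s n)) x)) \<le> V d \<psi> S x"
      using elim(2) by (intro Liminf_le) simp_all
    with elim(1) show ?case by (rule order_trans)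
  qed
qed

section \<open>Reduction to a single stopping time\<close>

lemma fun_upd_in_tuples_from:
  assumes "S \<in> \<Theta>" "i \<in> {1..d}" "\<tau> \<in> ({1..d} - {i}) \<rightarrow>\<^sub>E \<Theta>_from S"
  shows "\<tau>(i := S) \<in> tuples_from S"
proof (rule PiE_I)
  fix j assume "j \<in> {1..d}"
  then show "(\<tau>(i := S)) j \<in> \<Theta>_from S"
    using PiE_mem[OF assms(3), of j] self_in_\<Theta>_from[OF assms(1)] by simp
next
  fix j assume "j \<notin> {1..d}"
  then show "(\<tau>(i := S)) j = undefined" using PiE_arb[OF assms(3), of j] assms(2) by auto
qed

lemma u_coord_is_ess_sup:
  assumes S: "S \<in> \<Theta>" and i: "i \<in> {1..d}"
  shows "is_ess_sup M (({1..d} - {i}) \<rightarrow>\<^sub>E \<Theta>_from S) (\<lambda>\<tau> x. ereal (reward S (\<tau>(i := S)) x))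
    (u_coord d \<psi> i S)"
  unfolding u_coord_def
  by (rule is_ess_sup_ess_sup)
    (rule measurable_pre_sigma_\<Theta>[OF S reward_measurable[OF S fun_upd_in_tuples_from[OF S i]]])

lemma u_coord_measurable:
  assumes S: "S \<in> \<Theta>" and i: "i \<in> {1..d}"
  shows "u_coord d \<psi> i S \<in> borel_measurable (pre_sigma S)"
  unfolding u_coord_def
proof (rule ess_sup_measurable_subalgebra[OF finite_measure_axioms pre_sigma_\<Theta>[OF S]])
  show "(\<lambda>x. ereal (reward S (\<tau>(i := S)) x)) \<in> borel_measurable (pre_sigma S)"
    if "\<tau> \<in> ({1..d} - {i}) \<rightarrow>\<^sub>E \<Theta>_from S" for \<tau>
    by (rule reward_measurable[OF S fun_upd_in_tuples_from[OF S i that]])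
  have "(\<lambda>j\<in>{1..d} - {i}. S) \<in> ({1..d} - {i}) \<rightarrow>\<^sub>E \<Theta>_from S"
    by (simp add: restrict_PiE_iff self_in_\<Theta>_from[OF S])
  then show "({1..d} - {i}) \<rightarrow>\<^sub>E \<Theta>_from S \<noteq> {}" by (metis empty_iff)
qed

lemma reward_le_u_coord:
  assumes S: "S \<in> \<Theta>" and i: "i \<in> {1..d}" and \<tau>: "\<tau> \<in> tuples_from S" and eq: "\<tau> i = S"
  shows "AE x in M. ereal (reward S \<tau> x) \<le> u_coord d \<psi> i S x"
proof -
  let ?\<tau> = "restrict \<tau> ({1..d} - {i})"
  have "?\<tau> \<in> ({1..d} - {i}) \<rightarrow>\<^sub>E \<Theta>_from S"
    unfolding restrict_PiE_iff by (intro ballI PiE_mem[OF \<tau>]) simp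
  then have "AE x in M. ereal (reward S (?\<tau>(i := S)) x) \<le> u_coord d \<psi> i S x"
    by (rule is_ess_supD(2)[OF u_coord_is_ess_sup[OF S i]])
  moreover have "?\<tau>(i := S) = \<tau>"
    using eq PiE_arb[OF \<tau>] by (auto simp: fun_eq_iff restrict_def)
  ultimately show ?thesis by simp
qed

lemma u_coord_le_V:
  assumes S: "S \<in> \<Theta>" and i: "i \<in> {1..d}"
  shows "AE x in M. u_coord d \<psi> i S x \<le> V d \<psi> S x"
proof -
  have "V d \<psi> S \<in> borel_measurable M" by (rule measurable_pre_sigma_\<Theta>[OF S V_measurable[OF S]])
  then show ?thesis
  proof (rule is_ess_supD(3)[OF u_coord_is_ess_sup[OF S i]])
    show "AE x in M. ereal (reward S (\<tau>(i := S)) x) \<le> V d \<psi> S x"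
      if "\<tau> \<in> ({1..d} - {i}) \<rightarrow>\<^sub>E \<Theta>_from S" for \<tau>
      by (rule reward_le_V[OF S fun_upd_in_tuples_from[OF S i that]])
  qed
qed

lemma \<phi>_measurable:
  assumes S: "S \<in> \<Theta>"
  shows "\<phi> d \<psi> S \<in> borel_measurable (pre_sigma S)"
proof -
  have "\<phi> d \<psi> S = (\<lambda>x. SUP i\<in>{1..d}. u_coord d \<psi> i S x)"
    using d by (intro ext) (simp add: \<phi>_def Max_Sup)
  then show ?thesis
    using u_coord_measurable[OF S] by (simp add: borel_measurable_SUP)
qed

text \<open>Each \<open>u_coord\<close> is an essential supremum over a subfamily of the tuples that define \<open>V\<close>.\<close>

lemma \<phi>_le_V:
  assumes S: "S \<in> \<Theta>"
  shows "AE x in M. \<phi> d \<psi> S x \<le> V d \<psi> S x"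
proof -
  have "AE x in M. \<forall>i\<in>{1..d}. u_coord d \<psi> i S x \<le> V d \<psi> S x"
    by (intro AE_finite_allI u_coord_le_V[OF S]) auto
  then show ?thesis by eventually_elim (use d in \<open>simp add: \<phi>_def\<close>)
qed

lemma reward_le_\<phi>:
  assumes S: "S \<in> \<Theta>" and i: "i \<in> {1..d}" and \<tau>: "\<tau> \<in> tuples_from S" and eq: "\<tau> i = S"
  shows "AE x in M. ereal (reward S \<tau> x) \<le> \<phi> d \<psi> S x"
  using reward_le_u_coord[OF assms]
proof eventually_elim
  case (elim x)
  also have "u_coord d \<psi> i S x \<le> \<phi> d \<psi> S x" unfolding \<phi>_def using i by (intro Max_ge) auto
  finally show ?case .
qed

text \<open>The lower bound is the reward of stopping all components at \<open>S\<close>, the upper one is \<open>V\<close>;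
  both are finite and in \<open>L\<^sup>p\<close>.\<close>

lemma \<phi>_real:
  assumes S: "S \<in> \<Theta>"
  shows "AE x in M. ereal (real_of_ereal (\<phi> d \<psi> S x)) = \<phi> d \<psi> S x"
    and "(\<lambda>x. real_of_ereal (\<phi> d \<psi> S x)) \<in> Lp_space M p (pre_sigma S)"
proof -
  let ?c = "\<lambda>i\<in>{1..d}. S"
  have c: "?c \<in> tuples_from S" by (rule const_in_tuples[OF S])
  have low: "AE x in M. ereal (reward S ?c x) \<le> \<phi> d \<psi> S x"
    by (rule reward_le_\<phi>[OF S _ c, of 1]) (use d in auto)
  show eq: "AE x in M. ereal (real_of_ereal (\<phi> d \<psi> S x)) = \<phi> d \<psi> S x"
    using low \<phi>_le_V[OF S] V_real(1)[OF S]
  proof eventually_elim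
    case (elim x)
    then show ?case by (cases "\<phi> d \<psi> S x"; cases "V d \<psi> S x") auto
  qed
  have m: "(\<lambda>x. real_of_ereal (\<phi> d \<psi> S x)) \<in> borel_measurable (pre_sigma S)"
    by (rule borel_measurable_real_of_ereal[OF \<phi>_measurable[OF S]])
  have r: "reward S ?c \<in> Lp_space M p (pre_sigma S)" by (rule reward_Lp[OF S c])
  have "reward S ?c \<in> borel_measurable (pre_sigma S)" using r unfolding Lp_space_def by blast
  then have rM: "reward S ?c \<in> Lp_space M p M"
    by (rule Lp_space_change_algebra[OF r measurable_pre_sigma_\<Theta>[OF S]])
  have VM: "(\<lambda>x. real_of_ereal (V d \<psi> S x)) \<in> Lp_space M p M" using V_int[OF S] by (rule conjunct2)
  show "(\<lambda>x. real_of_ereal (\<phi> d \<psi> S x)) \<in> Lp_space M p (pre_sigma S)"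
  proof (rule Lp_space_between[OF rM VM measurable_pre_sigma_\<Theta>[OF S m] m])
    show "AE x in M. reward S ?c x \<le> real_of_ereal (\<phi> d \<psi> S x)"
      using low eq by eventually_elim (metis ereal_less_eq(3))
    show "AE x in M. real_of_ereal (\<phi> d \<psi> S x) \<le> real_of_ereal (V d \<psi> S x)"
      using \<phi>_le_V[OF S] eq V_real(1)[OF S] by eventually_elim (metis ereal_less_eq(3))
  qed
qed

text \<open>At the first time \<open>m\<close> of a tuple some component equals \<open>m\<close>. Where it is component \<open>i\<close>,
  replacing \<open>\<tau> i\<close> by \<open>m\<close> changes nothing on that event and leaves the minimum as it is, so the
  \<open>d\<close>-property identifies the reward there with one that competes in \<open>u_coord d \<psi> i m\<close>.\<close>

lemma reward_min_le_\<phi>: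
  assumes \<tau>: "\<tau> \<in> {1..d} \<rightarrow>\<^sub>E \<Theta>"
  defines "m \<equiv> tuple_min d \<tau>"
  shows "AE x in M. ereal (reward m \<tau> x) \<le> \<phi> d \<psi> m x"
proof -
  have \<tau>i: "\<tau> i \<in> \<Theta>" if "i \<in> {1..d}" for i by (rule PiE_mem[OF \<tau> that])
  have m: "m \<in> \<Theta>" unfolding m_def by (rule tuple_min_in_\<Theta>[OF d \<tau>i])
  have m_le: "m x \<le> \<tau> i x" if "i \<in> {1..d}" for i x unfolding m_def by (rule tuple_min_le[OF that])
  have "AE x in M. \<tau> i x = m x \<longrightarrow> ereal (reward m \<tau> x) \<le> \<phi> d \<psi> m x" if i: "i \<in> {1..d}" for i
  proof -
    let ?A = "{x \<in> space M. m x = \<tau> i x}" and ?\<tau> = "\<tau>(i := m)"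
    have A: "?A \<in> sets (pre_sigma m)" by (rule pre_sigma_eq[OF \<Theta>D(1)[OF m] \<Theta>D(1)[OF \<tau>i[OF i]]])
    have "?\<tau> j \<in> \<Theta>_from m" if "j \<in> {1..d}" for j
      using \<tau>i[OF that] m_le[OF that] m by (auto intro: \<Theta>_fromI)
    then have up: "?\<tau> \<in> tuples_from m"
      using PiE_arb[OF \<tau>] i by (intro PiE_I) auto
    have up_min: "tuple_min d ?\<tau> = m"
    proof
      fix x
      have "\<exists>j\<in>{1..d}. tuple_min d ?\<tau> x = ?\<tau> j x" by (rule tuple_min_attained[OF d])
      then have "m x \<le> tuple_min d ?\<tau> x" using m_le by (auto split: if_splits)
      moreover have "tuple_min d ?\<tau> x \<le> m x" using tuple_min_le[OF i, of ?\<tau> x] by simp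
      ultimately show "tuple_min d ?\<tau> x = m x" by simp
    qed
    have "AE x in M. indicator ?A x * \<rho> m (tuple_max d \<tau>) (\<psi> \<tau>) x
        = indicator ?A x * \<rho> m (tuple_max d ?\<tau>) (\<psi> ?\<tau>) x"
    proof -
      have "\<forall>j\<in>{1..d}. AE x in M. x \<in> ?A \<longrightarrow> \<tau> j x = ?\<tau> j x" by auto
      moreover have "?A \<in> sets (pre_sigma (tuple_min d \<tau>))" using A by (simp add: m_def)
      ultimately have "AE x in M. indicator ?A x * \<rho> (tuple_min d \<tau>) (tuple_max d \<tau>) (\<psi> \<tau>) x
        = indicator ?A x * \<rho> (tuple_min d ?\<tau>) (tuple_max d ?\<tau>) (\<psi> ?\<tau>) x"
        using dprop[unfolded d_property_def, rule_format, OF adm int \<tau> tuples_fromD(1)[OF up]]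
        by blast
      then show ?thesis by (simp only: up_min m_def[symmetric])
    qed
    moreover have "AE x in M. ereal (reward m ?\<tau> x) \<le> \<phi> d \<psi> m x"
      by (rule reward_le_\<phi>[OF m i up]) simp
    ultimately show ?thesis using AE_space
    proof eventually_elim
      case (elim x)
      show ?case
      proof
        assume "\<tau> i x = m x"
        with elim show "ereal (reward m \<tau> x) \<le> \<phi> d \<psi> m x" by simp
      qed
    qed
  qed
  then have "AE x in M. \<forall>i\<in>{1..d}. \<tau> i x = m x \<longrightarrow> ereal (reward m \<tau> x) \<le> \<phi> d \<psi> m x"
    by (intro AE_finite_allI) auto
  then show ?thesis
  proof eventually_elim
    case (elim x)
    obtain i where "i \<in> {1..d}" "\<tau> i x = m x"
      using tuple_min_attained[OF d, of \<tau> x] unfolding m_def by metis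
    with elim show ?case by blast
  qed
qed

lemma u_is_ess_sup:
  assumes S: "S \<in> \<Theta>"
  shows "is_ess_sup M (\<Theta>_from S)
    (\<lambda>\<tau> x. ereal (\<rho> S \<tau> (\<lambda>y. real_of_ereal (\<phi> d \<psi> \<tau> y)) x)) (u d \<psi> S)"
  unfolding u_def
proof (rule is_ess_sup_ess_sup)
  fix \<tau> assume "\<tau> \<in> \<Theta>_from S"
  then have \<tau>: "\<tau> \<in> \<Theta>" by (rule \<Theta>_fromD)
  have "\<rho> S \<tau> (\<lambda>y. real_of_ereal (\<phi> d \<psi> \<tau> y)) \<in> Lp_space M p (pre_sigma S)"
    by (rule \<rho>_Lp[OF S \<tau> \<phi>_real(2)[OF \<tau>]])
  then have "\<rho> S \<tau> (\<lambda>y. real_of_ereal (\<phi> d \<psi> \<tau> y)) \<in> borel_measurable (pre_sigma S)"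
    unfolding Lp_space_def by blast
  then show "(\<lambda>x. ereal (\<rho> S \<tau> (\<lambda>y. real_of_ereal (\<phi> d \<psi> \<tau> y)) x)) \<in> borel_measurable M"
    by (intro borel_measurable_ereal measurable_pre_sigma_\<Theta>[OF S])
qed

lemma u_le_V:
  assumes S: "S \<in> \<Theta>"
  shows "AE x in M. u d \<psi> S x \<le> V d \<psi> S x"
proof -
  have le: "AE x in M. ereal (\<rho> S \<tau> (\<lambda>y. real_of_ereal (\<phi> d \<psi> \<tau> y)) x) \<le> V d \<psi> S x"
    if \<tau>: "\<tau> \<in> \<Theta>_from S" for \<tau>
  proof -
    have \<tau>\<Theta>: "\<tau> \<in> \<Theta>" using \<tau> by (rule \<Theta>_fromD)
    have "AE x in M. real_of_ereal (\<phi> d \<psi> \<tau> x) \<le> real_of_ereal (V d \<psi> \<tau> x)"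
      using \<phi>_le_V[OF \<tau>\<Theta>] \<phi>_real(1)[OF \<tau>\<Theta>] V_real(1)[OF \<tau>\<Theta>]
      by eventually_elim (metis ereal_less_eq(3))
    from \<rho>_mono[OF S \<tau>\<Theta> \<phi>_real(2)[OF \<tau>\<Theta>] V_real(2)[OF \<tau>\<Theta>] this] \<rho>_V_le_V[OF S \<tau>]
    show ?thesis by eventually_elim (meson ereal_less_eq(3) order_trans)
  qed
  show ?thesis
    by (rule is_ess_supD(3)[OF u_is_ess_sup[OF S] measurable_pre_sigma_\<Theta>[OF S V_measurable[OF S]] le])
qed

text \<open>Pass from \<open>S\<close> to the maximum of the tuple through its minimum: the inner step is bounded by
  \<open>\<phi>\<close> at the minimum, which is one of the times competing in \<open>u\<close>.\<close>

lemma V_le_u: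
  assumes S: "S \<in> \<Theta>"
  shows "AE x in M. V d \<psi> S x \<le> u d \<psi> S x"
proof -
  have le: "AE x in M. ereal (reward S \<tau> x) \<le> u d \<psi> S x" if \<tau>: "\<tau> \<in> tuples_from S" for \<tau>
  proof -
    define m where "m = tuple_min d \<tau>"
    have mS: "m \<in> \<Theta>_from S" unfolding m_def by (rule tuples_fromD(5)[OF \<tau>])
    then have m: "m \<in> \<Theta>" by (rule \<Theta>_fromD)
    have "\<tau> i \<in> \<Theta>_from m" if "i \<in> {1..d}" for i
      using tuples_fromD(3)[OF \<tau> that] tuple_min_le[OF that, of \<tau>] by (simp add: m_def \<Theta>_fromI)
    then have \<tau>m: "\<tau> \<in> tuples_from m" using PiE_arb[OF \<tau>] by (intro PiE_I) auto
    have "AE x in M. ereal (reward m \<tau> x) \<le> \<phi> d \<psi> m x"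
      unfolding m_def by (rule reward_min_le_\<phi>[OF tuples_fromD(1)[OF \<tau>]])
    then have "AE x in M. reward m \<tau> x \<le> real_of_ereal (\<phi> d \<psi> m x)"
      using \<phi>_real(1)[OF m] by eventually_elim (metis ereal_less_eq(3))
    note \<rho>_mono[OF S m reward_Lp[OF m \<tau>m] \<phi>_real(2)[OF m] this]
    moreover have "AE x in M. ereal (\<rho> S m (\<lambda>y. real_of_ereal (\<phi> d \<psi> m y)) x) \<le> u d \<psi> S x"
      by (rule is_ess_supD(2)[OF u_is_ess_sup[OF S] mS])
    ultimately show ?thesis using reward_consistent[OF S mS \<tau>m]
      by eventually_elim (metis ereal_less_eq(3) order_trans)
  qed
  show ?thesis
    by (rule is_ess_supD(3)[OF V_is_ess_sup[OF S] is_ess_supD(1)[OF u_is_ess_sup[OF S]] le])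
qed

end

theorem theorem3:
  fixes M :: "'a measure"
    and F :: "real \<Rightarrow> 'a measure"
    and T :: real
    and \<theta> :: "nat \<Rightarrow> 'a \<Rightarrow> real"
    and p :: ennreal
    and \<rho> :: "('a \<Rightarrow> real) \<Rightarrow> ('a \<Rightarrow> real) \<Rightarrow> ('a \<Rightarrow> real) \<Rightarrow> 'a \<Rightarrow> real"
    and d :: nat
    and \<psi> :: "(nat \<Rightarrow> 'a \<Rightarrow> real) \<Rightarrow> 'a \<Rightarrow> real"
  assumes "bermudan_operators M F T \<theta> p \<rho>"
    and "2 \<le> d"
    and "bermudan_operators.d_property M F T \<theta> p \<rho> d"
    and "bermudan.d_admissible M F T \<theta> d \<psi>"
    and "bermudan.d_p_integrable M F T \<theta> p d \<psi>"
    and "\<And>S. S \<in> bermudan.\<Theta> M F T \<theta> \<Longrightarrow>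
           (AE x in M. \<bar>bermudan_operators.V M F T \<theta> \<rho> d \<psi> S x\<bar> \<noteq> \<infinity>) \<and>
           (\<lambda>x. real_of_ereal (bermudan_operators.V M F T \<theta> \<rho> d \<psi> S x)) \<in> Lp_space M p M"
  shows "\<forall>S\<in>bermudan.\<Theta> M F T \<theta>.
           AE x in M. bermudan_operators.u M F T \<theta> \<rho> d \<psi> S x
                    = bermudan_operators.V M F T \<theta> \<rho> d \<psi> S x"
proof -
  interpret bermudan_operators M F T \<theta> p \<rho> by (rule assms(1))
  have "multiple_stopping M F T \<theta> p \<rho> d \<psi>"
    by (rule multiple_stopping.intro[OF assms(1)], rule multiple_stopping_axioms.intro)
      (use assms(2) in simp, rule assms(4), rule assms(5))
  then interpret integrable_multiple_stopping M F T \<theta> p \<rho> d \<psi>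
    by (rule integrable_multiple_stopping.intro)
      (rule integrable_multiple_stopping_axioms.intro, rule assms(6), assumption, rule assms(3))
  show ?thesis
  proof
    fix S assume S: "S \<in> \<Theta>"
    show "AE x in M. u d \<psi> S x = V d \<psi> S x"
      using u_le_V[OF S] V_le_u[OF S] by eventually_elim (rule antisym)
  qed
qed

end
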